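(* Let $d\ge 2$ be a fixed integer and let $p=p_n\in(0,1)$ satisfy $p_n(1-p_n)\gg \frac{\log^4 n}{n^{d-1}}$. Let $H$ be the random $d$-uniform hypergraph $H(n,p_n)$ on $V=\{1,\dots,n\}$, conditioned to be connected, and for $i\in V$ let $H^i=\sum_{j\in V}\pi(j)H_{ij}$ be the average starting hitting time of $i$ for simple random walk on $H$. Then asymptotically almost surely $$\tfrac12 n(1+o(1))\le H^i\le n(1+o(1)),$$ i.e. for every $\varepsilon>0$ and every choice of vertices $i=i_n\in\{1,\dots,n\}$, the probability (over the random hypergraph) that $\frac12(1-\varepsilon)n\le H^i\le(1+\varepsilon)n$ tends to $1$ as $n\to\infty$.
   Context: Notation: $a_n\gg b_n$ means $b_n/a_n\to0$ as $n\to\infty$. The random $d$-uniform hypergraph $H(n,p)$ has vertex set $V=\{1,\dots,n\}$, and each $d$-element subset of $V$ is included in the (hyper)edge set $E$ independently with probability $p$. All probabilities are understood conditionally on the event that $H$ is connected (any two vertices are joined by a chain of successively intersecting hyperedges). Simple random walk on $H$: if the walk is at vertex $v$ at time $t$, it chooses uniformly a hyperedge $e\in E$ with $v\in e$, and then moves at time $t+1$ to a vertex $w\in e\setminus\{v\}$ chosen uniformly (probability $\frac1{d-1}$ each). Equivalently, it is simple random walk on the multigraph in which $v\ne w$ are joined by $k$ edges if exactly $k$ hyperedges contain both. Let $d_i=(d-1)\,|\{e\in E: i\in e\}|$ be the degree of $i$ in this multigraph. The invariant probability measure is $\pi(i)=d_i/\sum_{j\in V}d_j$. $H_{ij}$ denotes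 the expected time (in the random walk measure, for a fixed realization of the hypergraph) for the walk started at $i$ to reach $j$, with $H_{jj}=0$. Thus $H^i$ is a random variable with respect to the random hypergraph. *)

theory Defs
  imports "HOL-Probability.Probability"
begin

section \<open>The random uniform hypergraph\<close>

definition vertices :: "nat \<Rightarrow> nat set" where
  "vertices n = {1..n}"

definition potential_edges :: "nat \<Rightarrow> nat \<Rightarrow> nat set set" where
  "potential_edges d n = {e. e \<subseteq> vertices n \<and> card e = d}"

text \<open>A hypergraph on \<^term>\<open>vertices n\<close> is identified with its set of hyperedges.\<close>

definition random_hypergraph :: "nat \<Rightarrow> nat \<Rightarrow> real \<Rightarrow> nat set set pmf" where
  "random_hypergraph d n p =
     map_pmf (\<lambda>f. {e \<in> potential_edges d n. f e})
       (Pi_pmf (potential_edges d n) False (\<lambda>_. bernoulli_pmf p))"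

definition hconnected :: "nat \<Rightarrow> nat set set \<Rightarrow> bool" where
  "hconnected n E \<longleftrightarrow>
     (\<forall>v\<in>vertices n. \<forall>w\<in>vertices n. v \<noteq> w \<longrightarrow>
        (\<exists>es. es \<noteq> [] \<and> set es \<subseteq> E \<and> v \<in> hd es \<and> w \<in> last es \<and>
              successively (\<lambda>e f. e \<inter> f \<noteq> {}) es))"


section \<open>The law of a homogeneous Markov chain on trajectory space\<close>

text \<open>
  \<open>chain_kernel K x t \<omega>\<close> is the conditional law of the state at time \<open>t\<close> given the
  earlier states \<open>\<omega> 0, \<dots>, \<omega> (t - 1)\<close>, for the chain with transition kernel \<open>K\<close>
  started at \<open>x\<close>. The law on \<open>nat \<Rightarrow> 'a\<close> is the projective limit of the
  Ionescu-Tulcea theorem.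
\<close>

definition chain_kernel ::
    "('a \<Rightarrow> 'a pmf) \<Rightarrow> 'a \<Rightarrow> nat \<Rightarrow> (nat \<Rightarrow> 'a) \<Rightarrow> 'a measure" where
  "chain_kernel K x t \<omega> =
     measure_pmf (case t of 0 \<Rightarrow> return_pmf x | Suc s \<Rightarrow> K (\<omega> s))"

lemma Ionescu_Tulcea_chain_kernel:
  "Ionescu_Tulcea (chain_kernel K x) (\<lambda>_. count_space UNIV)"
proof (rule Ionescu_Tulcea.intro)
  fix i
  show "chain_kernel K x i
      \<in> measurable (PiM {0..<i} (\<lambda>_. count_space UNIV)) (subprob_algebra (count_space UNIV))"
  proof (cases i)
    case 0
    then show ?thesis
      by (simp add: chain_kernel_def[abs_def] measure_pmf_in_subprob_algebra)
  next
    case (Suc s)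
    have "(\<lambda>\<omega>. \<omega> s) \<in> measurable (PiM {0..<i} (\<lambda>_. count_space UNIV)) (count_space UNIV)"
      by (rule measurable_component_singleton) (simp add: Suc)
    moreover have "(\<lambda>y. measure_pmf (K y))
        \<in> measurable (count_space UNIV) (subprob_algebra (count_space UNIV))"
      by (simp add: measure_pmf_in_subprob_algebra)
    ultimately show ?thesis
      unfolding chain_kernel_def[abs_def] Suc
      by (simp add: measurable_compose[where f = "\<lambda>\<omega>. \<omega> s"])
  qed
qed (simp add: chain_kernel_def measure_pmf.prob_space_axioms)

definition chain_law :: "('a \<Rightarrow> 'a pmf) \<Rightarrow> 'a \<Rightarrow> (nat \<Rightarrow> 'a) measure" where
  "chain_law K x =
     projective_family.lim UNIV
       (Ionescu_Tulcea.CI (chain_kernel K x) (\<lambda>_. count_space UNIV)) (\<lambda>_. count_space UNIV)"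

text \<open>The finite-dimensional marginals are those of the Markov chain.\<close>

lemma emeasure_chain_law:
  "emeasure (chain_law K x) {\<omega>. \<forall>k\<le>n. \<omega> k = a k} =
     (if a 0 = x then \<Prod>k<n. ennreal (pmf (K (a k)) (a (Suc k))) else 0)"
proof -
  let ?M = "\<lambda>_::nat. count_space UNIV :: 'a measure"
  interpret IT: Ionescu_Tulcea "chain_kernel K x" ?M
    by (rule Ionescu_Tulcea_chain_kernel)
  let ?C = "\<lambda>m. IT.C 0 m (\<lambda>_. undefined)"
  let ?r = "\<lambda>m. restrict a {0..<m}"
  have r_eq: "{?r m} = PiE {0..<m} (\<lambda>k. {a k})" for m
    by (auto simp: PiE_iff extensional_def fun_eq_iff restrict_def)
  have r_sets: "{?r m} \<in> sets (PiM {0..<m} ?M)" for m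
    unfolding r_eq by (intro sets_PiM_I_finite) auto
  have r_space: "?r m \<in> space (PiM {0..<m} ?M)" for m
    by (simp add: space_PiM)
  have step: "emeasure (?C (Suc m)) {?r (Suc m)} =
      emeasure (chain_kernel K x m (?r m)) {a m} * emeasure (?C m) {?r m}" for m
  proof -
    have sp: "space (?C m) = space (PiM {0..<m} ?M)"
      using IT.space_C[of "\<lambda>_. undefined" 0 m] by simp
    have st: "sets (?C m) = sets (PiM {0..<m} ?M)"
      using IT.sets_C[of "\<lambda>_. undefined" 0 m] by simp
    have eP: "emeasure (IT.eP m \<omega>) {?r (Suc m)} =
        emeasure (chain_kernel K x m (?r m)) {a m} * indicator {?r m} \<omega>"
      if \<omega>: "\<omega> \<in> space (PiM {0..<m} ?M)" for \<omega>
    proof -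
      have ext: "\<omega> \<in> extensional {0..<m}"
        using \<omega> by (auto simp: space_PiM PiE_iff)
      have iff: "fun_upd \<omega> m y = ?r (Suc m) \<longleftrightarrow> \<omega> = ?r m \<and> y = a m" for y
        using ext
        by (auto simp: fun_eq_iff restrict_def extensional_def less_Suc_eq split: if_splits)
      have "(\<lambda>y. fun_upd \<omega> m y) -` {?r (Suc m)} \<inter> space (?M m) =
          (if \<omega> = ?r m then {a m} else {})"
        using iff by auto
      then show ?thesis
        using IT.emeasure_eP[OF \<omega> r_sets] by (auto split: split_indicator)
    qed
    have "emeasure (?C (Suc m)) {?r (Suc m)} =
        (\<integral>\<^sup>+ \<omega>. emeasure (IT.eP m \<omega>) {?r (Suc m)} \<partial>?C m)"
      using IT.measurable_eP[of m] r_sets[of "Suc m"] r_space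
      by (auto simp: sp st measurable_cong_sets[OF st refl]
          intro!: emeasure_bind[where N = "PiM {0..<Suc m} ?M"])
    also have "\<dots> = (\<integral>\<^sup>+ \<omega>. emeasure (chain_kernel K x m (?r m)) {a m} *
        indicator {?r m} \<omega> \<partial>?C m)"
      by (intro nn_integral_cong eP) (simp add: sp)
    also have "\<dots> = emeasure (chain_kernel K x m (?r m)) {a m} * emeasure (?C m) {?r m}"
      by (subst nn_integral_cmult_indicator) (simp_all add: st r_sets)
    finally show ?thesis .
  qed
  have C: "emeasure (?C (Suc m)) {?r (Suc m)} =
      (if a 0 = x then \<Prod>k<m. ennreal (pmf (K (a k)) (a (Suc k))) else 0)" for m
  proof (induction m)
    case 0
    have "emeasure (?C 0) {?r 0} = 1"
      using r_sets[of 0] by (simp add: restrict_def)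
    moreover have "emeasure (chain_kernel K x 0 (?r 0)) {a 0} = (if a 0 = x then 1 else 0)"
      by (simp add: chain_kernel_def emeasure_pmf_single)
    ultimately show ?case
      unfolding step[of 0] by simp
  next
    case (Suc m)
    have "emeasure (chain_kernel K x (Suc m) (?r (Suc m))) {a (Suc m)} =
        ennreal (pmf (K (a m)) (a (Suc m)))"
      by (simp add: chain_kernel_def emeasure_pmf_single)
    then show ?case
      unfolding step[of "Suc m"] Suc.IH by (simp add: mult.commute)
  qed
  have "{\<omega>. \<forall>k\<le>n. \<omega> k = a k} = IT.PF.emb UNIV {0..<Suc n} {?r (Suc n)}"
  proof -
    have "restrict \<omega> {0..<Suc n} = ?r (Suc n) \<longleftrightarrow> (\<forall>k\<le>n. \<omega> k = a k)" for \<omega>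
      by (simp add: fun_eq_iff restrict_def less_Suc_eq_le)
    then show ?thesis
      by (auto simp: prod_emb_def space_PiM simp del: restrict_apply)
  qed
  then have "emeasure (chain_law K x) {\<omega>. \<forall>k\<le>n. \<omega> k = a k} =
      emeasure (IT.CI {0..<Suc n}) {?r (Suc n)}"
    unfolding chain_law_def by (simp only: IT.lim[OF _ r_sets] finite_atLeastLessThan)
  also have "\<dots> = emeasure (?C (Suc n)) {?r (Suc n)}"
  proof -
    have "IT.PF.emb {0..<Suc n} {0..<Suc n} {?r (Suc n)} = {?r (Suc n)}"
      using r_sets[of "Suc n"] by (intro prod_emb_id) (auto dest: sets.sets_into_space simp: space_PiM)
    then show ?thesis
      using IT.emeasure_CI[OF subset_refl r_sets[of "Suc n"]] by simp
  qed
  finally show ?thesis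
    using C[of n] by simp
qed

text \<open>The first time \<open>t \<ge> 0\<close> at which the trajectory is at \<open>j\<close>; it is \<open>\<infinity>\<close> if there is none.\<close>

definition hitting_time :: "'a \<Rightarrow> (nat \<Rightarrow> 'a) \<Rightarrow> ennreal" where
  "hitting_time j \<omega> = (INF t\<in>{t. \<omega> t = j}. of_nat t)"


section \<open>Simple random walk on a hypergraph\<close>

text \<open>
  \<^const>\<open>pmf_of_set\<close> is unspecified on the empty set; this concerns only vertices lying in no
  hyperedge, and those do not occur in a connected hypergraph on at least two vertices.
\<close>

definition walk_step :: "nat set set \<Rightarrow> nat \<Rightarrow> nat pmf" where
  "walk_step E v = bind_pmf (pmf_of_set {e \<in> E. v \<in> e}) (\<lambda>e. pmf_of_set (e - {v}))"

definition expected_hitting_time :: "nat set set \<Rightarrow> nat \<Rightarrow> nat \<Rightarrow> ennreal" where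
  "expected_hitting_time E i j = (\<integral>\<^sup>+ \<omega>. hitting_time j \<omega> \<partial>chain_law (walk_step E) i)"

definition walk_degree :: "nat \<Rightarrow> nat set set \<Rightarrow> nat \<Rightarrow> nat" where
  "walk_degree d E i = (d - 1) * card {e \<in> E. i \<in> e}"

definition invariant_prob :: "nat \<Rightarrow> nat \<Rightarrow> nat set set \<Rightarrow> nat \<Rightarrow> real" where
  "invariant_prob d n E i = real (walk_degree d E i) / real (\<Sum>j\<in>vertices n. walk_degree d E j)"

definition avg_starting_hitting_time :: "nat \<Rightarrow> nat \<Rightarrow> nat set set \<Rightarrow> nat \<Rightarrow> ennreal" where
  "avg_starting_hitting_time d n E i =
     (\<Sum>j\<in>vertices n. ennreal (invariant_prob d n E j) * expected_hitting_time E i j)"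

end

theory Submission
  imports Defs
begin

text \<open>
Write \<open>P\<close> for the transition matrix, \<open>h\<^sub>j(i)\<close> for the expected time from \<open>i\<close> to \<open>j\<close>, and \<open>m\<^sub>j\<close> for the
mean of \<open>h\<^sub>j\<close> under the invariant law \<open>\<pi>\<close>. The function \<open>h\<^sub>j\<close> solves \<open>(I - P) h\<^sub>j = 1 - \<delta>\<^sub>j / \<pi>\<^sub>j\<close>. Summing
against \<open>\<pi>\<^sub>j\<close> shows that \<open>i \<mapsto> \<Sum>\<^sub>j \<pi>\<^sub>j h\<^sub>j(i)\<close> is harmonic, hence constant, so that the average starting
hitting time equals \<open>\<Sum>\<^sub>j \<pi>\<^sub>j m\<^sub>j\<close> for every starting vertex (\<open>random_target\<close>). It remains to show that
each \<open>\<pi>\<^sub>j m\<^sub>j\<close> is close to one.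

Pairing the equation for \<open>h\<^sub>j\<close> with functions gives \<open>\<E>(g, h\<^sub>j) = mean g - g(j)\<close> for the Dirichlet form \<open>\<E>\<close>,
and in particular \<open>\<E>(h\<^sub>j, h\<^sub>j) = m\<^sub>j\<close>. Cauchy--Schwarz against the indicator of \<open>j\<close> yields
\<open>\<pi>\<^sub>j m\<^sub>j \<ge> (1 - \<pi>\<^sub>j)\<^sup>2\<close>, and summation over \<open>j\<close> gives the lower bound \<open>n - 2\<close>, which is at least \<open>n / 2\<close>
once \<open>n \<ge> 4\<close> (\<open>mean_hit_ge\<close>). For the upper bound, evaluating the equation at \<open>j\<close> bounds \<open>\<pi>\<^sub>j m\<^sub>j - 1\<close> by
\<open>\<pi>\<^sub>j\<close> times the average of \<open>m\<^sub>j - h\<^sub>j\<close> over one step from \<open>j\<close>. If the chain satisfies a Poincare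
inequality with constant \<open>\<gamma>\<close> and no one-step probability exceeds \<open>\<rho>\<close>, then the variance of \<open>h\<^sub>j\<close> is at
most \<open>m\<^sub>j / \<gamma>\<close>, and \<open>x = \<pi>\<^sub>j m\<^sub>j\<close>, if it exceeds one, satisfies \<open>(x - 1)\<^sup>2 \<le> (\<rho> / \<gamma>) x\<close>
(\<open>mean_hit_quadratic\<close>). Thus \<open>x \<le> 1 + \<epsilon>\<close> as soon as \<open>\<rho> / \<gamma>\<close> is small in terms of \<open>\<epsilon>\<close>.

For the random hypergraph put \<open>M = p n\<^bsup>d - 1\<^esup>\<close>, the order of magnitude of the degrees, which grows
faster than \<open>log n\<close>. Exponential moment bounds and a union bound show that with high probability
every set \<open>S\<close> of at most \<open>n / 2\<close> vertices has at least a constant times \<open>M |S|\<close> hyperedges on its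
boundary, every vertex has at most \<open>3 M\<close> hyperedges, and every pair of vertices has at most \<open>\<beta> M\<close>
common ones, for any fixed \<open>\<beta> > 0\<close> (\<open>prob_not_expanding_tendsto_0\<close>). The first property implies
connectivity, so that the conditioning is harmless. Together with the second it yields, by Cheeger's
inequality (\<open>Cheeger\<close>), a gap \<open>\<gamma>\<close> that does not depend on \<open>n\<close>; together with the third it yields
\<open>\<rho> = O(\<beta>)\<close>. Choosing \<open>\<beta>\<close> small in terms of \<open>\<epsilon>\<close> finishes the proof.
\<close>

section \<open>Cheeger's inequality for weighted graphs\<close>

locale weighted_graph =
  fixes V :: "'a set" and w :: "'a \<Rightarrow> 'a \<Rightarrow> real"
  assumes finite_V: "finite V"
    and w_nonneg: "i \<in> V \<Longrightarrow> j \<in> V \<Longrightarrow> 0 \<le> w i j"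
    and w_sym: "i \<in> V \<Longrightarrow> j \<in> V \<Longrightarrow> w i j = w j i"
begin

definition cut :: "'a set \<Rightarrow> real" where
  "cut S = (\<Sum>i\<in>S. \<Sum>j\<in>V - S. w i j)"

lemma sum_indicator_differences:
  assumes "S \<subseteq> V"
  shows "(\<Sum>i\<in>V. \<Sum>j\<in>V. w i j * \<bar>indicator S i - indicator S j :: real\<bar>) = 2 * cut S"
proof -
  have split: "(\<Sum>i\<in>V. h i) = (\<Sum>i\<in>S. h i) + (\<Sum>i\<in>V - S. h i)" for h :: "'a \<Rightarrow> real"
    using sum.subset_diff[OF assms finite_V, of h] by simp
  have "(\<Sum>i\<in>V. \<Sum>j\<in>V. w i j * \<bar>indicator S i - indicator S j :: real\<bar>)
      = (\<Sum>i\<in>S. \<Sum>j\<in>V - S. w i j) + (\<Sum>i\<in>V - S. \<Sum>j\<in>S. w i j)"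
    unfolding split by simp
  also have "(\<Sum>i\<in>V - S. \<Sum>j\<in>S. w i j) = (\<Sum>j\<in>S. \<Sum>i\<in>V - S. w i j)"
    by (rule sum.swap)
  also have "\<dots> = (\<Sum>j\<in>S. \<Sum>i\<in>V - S. w j i)"
    using assms by (intro sum.cong refl w_sym) auto
  finally show ?thesis
    by (simp add: cut_def)
qed

text \<open>
Expansion is the case where \<open>g\<close> is an indicator function. A general \<open>g\<close> is a positive combination
of the indicators of its level sets, which form a chain inside the support, and both sides are
additive along this decomposition. The induction removes the lowest level: subtracting
the least positive value \<open>a\<close> on the support \<open>S\<close> shrinks the support and changes every difference
by exactly \<open>a\<close> times that of the indicator of \<open>S\<close>.
\<close>

lemma l1_isoperimetry:
  assumes expansion: "\<And>S. S \<subseteq> V \<Longrightarrow> 2 * card S \<le> card V \<Longrightarrow> \<kappa> * real (card S) \<le> cut S"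
    and g: "\<And>i. i \<in> V \<Longrightarrow> 0 \<le> g i" "2 * card {i \<in> V. 0 < g i} \<le> card V"
  shows "2 * \<kappa> * (\<Sum>i\<in>V. g i) \<le> (\<Sum>i\<in>V. \<Sum>j\<in>V. w i j * \<bar>g i - g j\<bar>)"
  using g
proof (induction "card {i \<in> V. 0 < g i}" arbitrary: g rule: less_induct)
  case less
  define S where "S = {i \<in> V. 0 < g i}"
  have S: "S \<subseteq> V" "finite S" "2 * card S \<le> card V"
    using finite_V less.prems by (auto simp: S_def)
  show ?case
  proof (cases "S = {}")
    case True
    then have "g i = 0" if "i \<in> V" for i
      using that less.prems(1)[of i] unfolding S_def by fastforce
    then show ?thesis
      by (auto intro!: sum_nonneg w_nonneg)
  next
    case False
    define a where "a = Min (g ` S)"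
    define g' where "g' i = g i - a * indicator S i" for i
    have a_le: "a \<le> g i" if "i \<in> S" for i
      using that S(2) by (simp add: a_def)
    obtain m where m: "m \<in> S" "g m = a"
      using Min_in[of "g ` S"] False S(2) unfolding a_def by fastforce
    have a: "0 < a"
      using m by (auto simp: S_def)
    have outside: "g i = 0" if "i \<in> V - S" for i
      using that less.prems(1)[of i] unfolding S_def by fastforce
    have g'_nonneg: "0 \<le> g' i" if "i \<in> V" for i
      using that a_le[of i] outside[of i] by (cases "i \<in> S") (auto simp: g'_def)
    have "{i \<in> V. 0 < g' i} \<subset> S"
    proof (rule psubsetI)
      show "{i \<in> V. 0 < g' i} \<subseteq> S"
      proof (rule subsetI, rule ccontr)
        fix i assume "i \<in> {i \<in> V. 0 < g' i}" "i \<notin> S"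
        then show False
          using outside[of i] by (simp add: g'_def)
      qed
      show "{i \<in> V. 0 < g' i} \<noteq> S"
        using m by (force simp: g'_def)
    qed
    then have smaller: "card {i \<in> V. 0 < g' i} < card S"
      by (rule psubset_card_mono[OF S(2)])
    have IH: "2 * \<kappa> * (\<Sum>i\<in>V. g' i) \<le> (\<Sum>i\<in>V. \<Sum>j\<in>V. w i j * \<bar>g' i - g' j\<bar>)"
      using smaller S(3) g'_nonneg by (intro less.hyps) (auto simp: S_def)
    have diff: "\<bar>g i - g j\<bar> = \<bar>g' i - g' j\<bar> + a * \<bar>indicator S i - indicator S j\<bar>"
      if "i \<in> V" "j \<in> V" for i j
      using that a a_le[of i] a_le[of j] outside[of i] outside[of j]
      by (auto simp: g'_def indicator_def)
    have "(\<Sum>i\<in>V. indicator S i :: real) = card S"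
      using S(1) finite_V by (simp add: indicator_def of_bool_def sum.If_cases Int_absorb1)
    then have sum_g: "(\<Sum>i\<in>V. g i) = (\<Sum>i\<in>V. g' i) + a * card S"
      by (simp add: g'_def sum_subtractf flip: sum_distrib_left)
    have "(\<Sum>i\<in>V. \<Sum>j\<in>V. w i j * \<bar>g i - g j\<bar>)
        = (\<Sum>i\<in>V. \<Sum>j\<in>V. w i j * \<bar>g' i - g' j\<bar> + a * (w i j * \<bar>indicator S i - indicator S j\<bar>))"
      by (intro sum.cong refl) (simp add: diff algebra_simps)
    also have "\<dots> = (\<Sum>i\<in>V. \<Sum>j\<in>V. w i j * \<bar>g' i - g' j\<bar>) + a * (2 * cut S)"
      by (simp only: sum.distrib sum_distrib_left[symmetric] sum_indicator_differences[OF S(1)])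
    also have "\<dots> \<ge> 2 * \<kappa> * (\<Sum>i\<in>V. g' i) + a * (2 * (\<kappa> * card S))"
      using expansion[OF S(1,3)] a IH by (intro add_mono mult_left_mono) auto
    finally show ?thesis
      unfolding sum_g by (simp add: algebra_simps)
  qed
qed

lemma double_sum_Cauchy_Schwarz:
  fixes a b :: "'a \<Rightarrow> 'a \<Rightarrow> real"
  shows "(\<Sum>i\<in>V. \<Sum>j\<in>V. w i j * (a i j * b i j))\<^sup>2
    \<le> (\<Sum>i\<in>V. \<Sum>j\<in>V. w i j * (a i j)\<^sup>2) * (\<Sum>i\<in>V. \<Sum>j\<in>V. w i j * (b i j)\<^sup>2)"
proof -
  have *: "(\<Sum>i\<in>V. \<Sum>j\<in>V. w i j * h i j) =
      (\<Sum>(i, j)\<in>V \<times> V. w i j * h i j)" for h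
    by (simp add: sum.cartesian_product)
  have "(\<Sum>(i, j)\<in>V \<times> V. w i j * (a i j * b i j)) =
     (\<Sum>e\<in>V \<times> V. (sqrt (w (fst e) (snd e)) * a (fst e) (snd e)) *
        (sqrt (w (fst e) (snd e)) * b (fst e) (snd e)))"
    by (intro sum.cong) (auto simp: w_nonneg)
  moreover have "(\<Sum>(i, j)\<in>V \<times> V. w i j * (a i j)\<^sup>2) =
     (\<Sum>e\<in>V \<times> V. (sqrt (w (fst e) (snd e)) * a (fst e) (snd e))\<^sup>2)" for a :: "'a \<Rightarrow> 'a \<Rightarrow> real"
    by (intro sum.cong) (auto simp: w_nonneg power_mult_distrib)
  ultimately show ?thesis
    unfolding * by (simp only: Cauchy_Schwarz_ineq_sum)
qed

text \<open>
The \<open>l\<^sup>1\<close> inequality is applied to \<open>g\<^sup>2\<close>. Factoring \<open>g\<^sub>i\<^sup>2 - g\<^sub>j\<^sup>2\<close> and using Cauchy--Schwarz splits the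
right-hand side into the Dirichlet form of \<open>g\<close> and a term that the degree bound controls by
\<open>4\<Delta> \<Sum> g\<^sub>i\<^sup>2\<close>; one factor \<open>\<Sum> g\<^sub>i\<^sup>2\<close> then cancels.
\<close>

lemma Cheeger_small_support:
  assumes expansion: "\<And>S. S \<subseteq> V \<Longrightarrow> 2 * card S \<le> card V \<Longrightarrow> \<kappa> * real (card S) \<le> cut S"
    and \<kappa>: "0 \<le> \<kappa>"
    and degree: "\<And>i. i \<in> V \<Longrightarrow> (\<Sum>j\<in>V. w i j) \<le> \<Delta>"
    and g: "\<And>i. i \<in> V \<Longrightarrow> 0 \<le> g i" "2 * card {i \<in> V. 0 < g i} \<le> card V"
  shows "\<kappa>\<^sup>2 * (\<Sum>i\<in>V. (g i)\<^sup>2) \<le> \<Delta> * (\<Sum>i\<in>V. \<Sum>j\<in>V. w i j * (g i - g j)\<^sup>2)"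
proof -
  define G where "G = (\<Sum>i\<in>V. (g i)\<^sup>2)"
  define D where "D = (\<Sum>i\<in>V. \<Sum>j\<in>V. w i j * (g i - g j)\<^sup>2)"
  have pos: "{i \<in> V. 0 < (g i)\<^sup>2} = {i \<in> V. 0 < g i}"
    using g(1) by force
  have G0: "0 \<le> G" and D0: "0 \<le> D"
    unfolding G_def D_def by (auto intro!: sum_nonneg mult_nonneg_nonneg w_nonneg)
  have sums: "(\<Sum>i\<in>V. \<Sum>j\<in>V. w i j * (g i + g j)\<^sup>2) \<le> 4 * \<Delta> * G"
  proof -
    have "(\<Sum>i\<in>V. \<Sum>j\<in>V. w i j * (g i + g j)\<^sup>2)
        \<le> (\<Sum>i\<in>V. \<Sum>j\<in>V. w i j * (2 * (g i)\<^sup>2 + 2 * (g j)\<^sup>2))"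
    proof (intro sum_mono mult_left_mono w_nonneg)
      show "(g i + g j)\<^sup>2 \<le> 2 * (g i)\<^sup>2 + 2 * (g j)\<^sup>2" for i j
        using sum_squares_ge_zero[of "g i - g j" 0] by (simp add: power2_eq_square algebra_simps)
    qed auto
    also have "\<dots> = (\<Sum>i\<in>V. \<Sum>j\<in>V. 2 * (g i)\<^sup>2 * w i j) + (\<Sum>i\<in>V. \<Sum>j\<in>V. 2 * (g j)\<^sup>2 * w i j)"
      by (simp add: algebra_simps sum.distrib)
    also have "(\<Sum>i\<in>V. \<Sum>j\<in>V. 2 * (g j)\<^sup>2 * w i j) = (\<Sum>j\<in>V. \<Sum>i\<in>V. 2 * (g j)\<^sup>2 * w j i)"
      by (subst sum.swap) (intro sum.cong refl, simp add: w_sym)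
    also have "(\<Sum>i\<in>V. \<Sum>j\<in>V. 2 * (g i)\<^sup>2 * w i j) + (\<Sum>j\<in>V. \<Sum>i\<in>V. 2 * (g j)\<^sup>2 * w j i)
        = (\<Sum>i\<in>V. 4 * (g i)\<^sup>2 * (\<Sum>j\<in>V. w i j))"
      by (simp add: sum_distrib_left flip: sum.distrib) (intro sum.cong refl, simp)
    also have "\<dots> \<le> (\<Sum>i\<in>V. 4 * (g i)\<^sup>2 * \<Delta>)"
      by (intro sum_mono mult_left_mono degree) auto
    also have "\<dots> = 4 * \<Delta> * G"
      by (simp add: G_def sum_distrib_left mult_ac)
    finally show ?thesis .
  qed
  have "2 * \<kappa> * G \<le> (\<Sum>i\<in>V. \<Sum>j\<in>V. w i j * \<bar>(g i)\<^sup>2 - (g j)\<^sup>2\<bar>)"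
    unfolding G_def using g by (intro l1_isoperimetry expansion) (auto simp only: pos zero_le_power2)
  also have "\<dots> = (\<Sum>i\<in>V. \<Sum>j\<in>V. w i j * (\<bar>g i - g j\<bar> * (g i + g j)))"
    using g(1) by (intro sum.cong refl) (simp add: square_diff_square_factored abs_mult power2_eq_square mult_ac)
  finally have "(2 * \<kappa> * G)\<^sup>2 \<le> (\<Sum>i\<in>V. \<Sum>j\<in>V. w i j * (\<bar>g i - g j\<bar> * (g i + g j)))\<^sup>2"
    using \<kappa> G0 by (intro power_mono) auto
  also have "\<dots> \<le> D * (\<Sum>i\<in>V. \<Sum>j\<in>V. w i j * (g i + g j)\<^sup>2)"
    using double_sum_Cauchy_Schwarz[of "\<lambda>i j. \<bar>g i - g j\<bar>" "\<lambda>i j. g i + g j"] by (simp add: D_def)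
  also have "\<dots> \<le> D * (4 * \<Delta> * G)"
    using D0 sums by (rule mult_left_mono[rotated])
  finally have "G * (\<kappa>\<^sup>2 * G) \<le> G * (\<Delta> * D)"
    by (simp add: power2_eq_square algebra_simps)
  moreover have "0 \<le> \<Delta> * D"
  proof (cases "V = {}")
    case True
    then show ?thesis by (simp add: D_def)
  next
    case False
    then obtain i where "i \<in> V" by auto
    then have "0 \<le> \<Delta>"
      using degree[of i] sum_nonneg[of V "w i"] w_nonneg by force
    then show ?thesis using D0 by simp
  qed
  ultimately have "\<kappa>\<^sup>2 * G \<le> \<Delta> * D"
    using G0 by (cases "G = 0") auto
  then show ?thesis
    by (simp add: G_def D_def)
qed

text \<open>
The least value of \<open>f\<close> that at most half of the vertices exceed is a median: the next smaller value is
exceeded by more than half of them, which leaves less than half below the median.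
\<close>

lemma median_exists:
  fixes f :: "'a \<Rightarrow> real"
  shows "\<exists>c. 2 * card {i \<in> V. c < f i} \<le> card V \<and> 2 * card {i \<in> V. f i < c} \<le> card V"
proof (cases "V = {}")
  case False
  define C where "C = {c \<in> f ` V. 2 * card {i \<in> V. c < f i} \<le> card V}"
  have finite_C: "finite C"
    using finite_V by (simp add: C_def)
  have none: "{i \<in> V. Max (f ` V) < f i} = {}"
    using finite_V by (auto simp: not_less)
  have "Max (f ` V) \<in> C"
    unfolding C_def mem_Collect_eq none using False finite_V by simp
  then have "Min C \<in> C"
    using finite_C by (intro Min_in) auto
  define c where "c = Min C"
  have c: "2 * card {i \<in> V. c < f i} \<le> card V"
    using \<open>Min C \<in> C\<close> by (simp add: C_def c_def)
  have "2 * card {i \<in> V. f i < c} \<le> card V"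
  proof (cases "{i \<in> V. f i < c} = {}")
    case False
    define b where "b = Max (f ` {i \<in> V. f i < c})"
    have "b \<in> f ` {i \<in> V. f i < c}"
      unfolding b_def using False finite_V by (intro Max_in) auto
    then have b: "b \<in> f ` V" "b < c"
      by auto
    then have "b \<notin> C"
      using Min_le[OF finite_C, of b] by (auto simp: c_def)
    then have "card V < 2 * card {i \<in> V. b < f i}"
      using b by (simp add: C_def)
    moreover have "card {i \<in> V. b < f i} + card {i \<in> V. f i < c} \<le> card V"
    proof -
      have "f i \<le> b" if "i \<in> V" "f i < c" for i
        unfolding b_def using that finite_V by (intro Max_ge) auto
      then have "{i \<in> V. b < f i} \<inter> {i \<in> V. f i < c} = {}"
        by force
      then have "card {i \<in> V. b < f i} + card {i \<in> V. f i < c}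
          = card ({i \<in> V. b < f i} \<union> {i \<in> V. f i < c})"
        using finite_V by (intro card_Un_disjoint[symmetric]) auto
      also have "\<dots> \<le> card V"
        using finite_V by (intro card_mono) auto
      finally show ?thesis .
    qed
    ultimately show ?thesis by linarith
  qed (simp only: card.empty)
  with c show ?thesis by blast
qed simp

text \<open>
Centring at a median \<open>c\<close> makes the positive and the negative part of \<open>f - c\<close> each live on at most
half of the vertices, so that both are covered by the previous inequality. Their Dirichlet forms
add up to at most that of \<open>f\<close>, because both contribute to a difference of values of \<open>f\<close> with the
same sign.
An unspecified centre \<open>c\<close> suffices for bounding variances, since the mean square deviation from the
mean is the smallest one.
\<close>

theorem Cheeger:
  assumes expansion: "\<And>S. S \<subseteq> V \<Longrightarrow> 2 * card S \<le> card V \<Longrightarrow> \<kappa> * real (card S) \<le> cut S"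
    and \<kappa>: "0 \<le> \<kappa>"
    and degree: "\<And>i. i \<in> V \<Longrightarrow> (\<Sum>j\<in>V. w i j) \<le> \<Delta>" "0 \<le> \<Delta>"
  shows "\<exists>c. \<kappa>\<^sup>2 * (\<Sum>i\<in>V. (f i - c)\<^sup>2) \<le> \<Delta> * (\<Sum>i\<in>V. \<Sum>j\<in>V. w i j * (f i - f j)\<^sup>2)"
proof -
  obtain c where c: "2 * card {i \<in> V. c < f i} \<le> card V" "2 * card {i \<in> V. f i < c} \<le> card V"
    using median_exists by blast
  define g where "g i = max 0 (f i - c)" for i
  define h where "h i = max 0 (c - f i)" for i
  have supp: "{i \<in> V. 0 < g i} = {i \<in> V. c < f i}" "{i \<in> V. 0 < h i} = {i \<in> V. f i < c}"
    by (auto simp: g_def h_def)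
  have "\<kappa>\<^sup>2 * (\<Sum>i\<in>V. (f i - c)\<^sup>2) = \<kappa>\<^sup>2 * (\<Sum>i\<in>V. (g i)\<^sup>2) + \<kappa>\<^sup>2 * (\<Sum>i\<in>V. (h i)\<^sup>2)"
    unfolding distrib_left[symmetric] sum.distrib[symmetric]
    by (intro arg_cong2[of _ _ _ _ "(*)"] sum.cong refl) (auto simp: g_def h_def max_def power2_commute)
  also have "\<dots> \<le> \<Delta> * (\<Sum>i\<in>V. \<Sum>j\<in>V. w i j * (g i - g j)\<^sup>2)
      + \<Delta> * (\<Sum>i\<in>V. \<Sum>j\<in>V. w i j * (h i - h j)\<^sup>2)"
    using c by (intro add_mono Cheeger_small_support expansion degree \<kappa>)
      (simp_all add: supp, simp_all add: g_def h_def)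
  also have "\<dots> = \<Delta> * (\<Sum>i\<in>V. \<Sum>j\<in>V. w i j * ((g i - g j)\<^sup>2 + (h i - h j)\<^sup>2))"
    by (simp add: distrib_left sum.distrib)
  also have "\<dots> \<le> \<Delta> * (\<Sum>i\<in>V. \<Sum>j\<in>V. w i j * (f i - f j)\<^sup>2)"
  proof (intro mult_left_mono sum_mono w_nonneg degree)
    fix i j
    have "0 \<le> (g i - g j) * (h j - h i)"
      by (cases "f i \<le> f j") (auto simp: g_def h_def max_def mult_nonneg_nonneg mult_nonpos_nonpos)
    then have "(g i - g j)\<^sup>2 + (h i - h j)\<^sup>2 \<le> ((g i - g j) + (h j - h i))\<^sup>2"
      unfolding power2_sum[of "g i - g j"] power2_commute[of "h i"] mult.assoc by linarith
    also have "(g i - g j) + (h j - h i) = f i - f j"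
      by (auto simp: g_def h_def max_def)
    finally show "(g i - g j)\<^sup>2 + (h i - h j)\<^sup>2 \<le> (f i - f j)\<^sup>2" .
  qed
  finally show ?thesis ..
qed

end

section \<open>Reversible chains with a spectral gap\<close>

text \<open>
The probability that the chain started at \<open>x\<close> spends the times \<open>1, \<dots>, t\<close> in \<open>B\<close>. The starting
point is exempt from the requirement, which makes the recursion on the first step uniform.
\<close>

primrec survival :: "('a \<Rightarrow> 'a pmf) \<Rightarrow> 'a set \<Rightarrow> nat \<Rightarrow> 'a \<Rightarrow> real" where
  "survival K B 0 x = 1"
| "survival K B (Suc t) x = (\<Sum>y\<in>B. pmf (K x) y * survival K B t y)"

lemma survival_nonneg: "0 \<le> survival K B t x"
  by (induction t arbitrary: x) (auto intro!: sum_nonneg)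

locale reversible_chain =
  fixes V :: "'a set" and K :: "'a \<Rightarrow> 'a pmf" and \<pi> :: "'a \<Rightarrow> real"
  assumes finite_V: "finite V"
    and closed: "i \<in> V \<Longrightarrow> set_pmf (K i) \<subseteq> V"
    and \<pi>_pos: "i \<in> V \<Longrightarrow> 0 < \<pi> i"
    and sum_\<pi>: "(\<Sum>i\<in>V. \<pi> i) = 1"
    and reversible: "i \<in> V \<Longrightarrow> j \<in> V \<Longrightarrow> \<pi> i * pmf (K i) j = \<pi> j * pmf (K j) i"
begin

sublocale weighted_graph V "\<lambda>i j. \<pi> i * pmf (K i) j"
  using finite_V \<pi>_pos reversible by unfold_locales (auto simp: less_imp_le)

lemma sum_pmf_row: "i \<in> V \<Longrightarrow> (\<Sum>j\<in>V. pmf (K i) j) = 1"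
  by (intro sum_pmf_eq_1 finite_V closed)

text \<open>
The operator \<open>I - P\<close>, the negative of the generator of the chain.
\<close>

definition defect :: "('a \<Rightarrow> real) \<Rightarrow> 'a \<Rightarrow> real" where
  "defect f i = f i - (\<Sum>k\<in>V. pmf (K i) k * f k)"

text \<open>
The Dirichlet form of the chain.
\<close>

definition energy :: "('a \<Rightarrow> real) \<Rightarrow> ('a \<Rightarrow> real) \<Rightarrow> real" where
  "energy g f = (1 / 2) * (\<Sum>i\<in>V. \<Sum>j\<in>V. \<pi> i * pmf (K i) j * ((g i - g j) * (f i - f j)))"

definition mean :: "('a \<Rightarrow> real) \<Rightarrow> real" where
  "mean f = (\<Sum>i\<in>V. \<pi> i * f i)"

lemma Green: "mean (\<lambda>i. g i * defect f i) = energy g f"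
proof -
  let ?Q = "\<lambda>i j. \<pi> i * pmf (K i) j"
  have row: "(\<Sum>i\<in>V. \<Sum>j\<in>V. ?Q i j * a i) = (\<Sum>i\<in>V. \<pi> i * a i)" for a :: "'a \<Rightarrow> real"
  proof (intro sum.cong refl)
    fix i assume i: "i \<in> V"
    have "(\<Sum>j\<in>V. ?Q i j * a i) = \<pi> i * a i * (\<Sum>j\<in>V. pmf (K i) j)"
      by (simp add: sum_distrib_left mult_ac)
    then show "(\<Sum>j\<in>V. ?Q i j * a i) = \<pi> i * a i"
      by (simp add: sum_pmf_row[OF i])
  qed
  have flip: "(\<Sum>i\<in>V. \<Sum>j\<in>V. ?Q i j * b i j) = (\<Sum>i\<in>V. \<Sum>j\<in>V. ?Q i j * b j i)"
    for b :: "'a \<Rightarrow> 'a \<Rightarrow> real"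
    by (subst sum.swap) (intro sum.cong refl arg_cong2[of _ _ _ _ "(*)"] reversible)
  have "energy g f = (1 / 2) * ((\<Sum>i\<in>V. \<Sum>j\<in>V. ?Q i j * (g i * f i))
      - (\<Sum>i\<in>V. \<Sum>j\<in>V. ?Q i j * (g i * f j))
      - (\<Sum>i\<in>V. \<Sum>j\<in>V. ?Q i j * (g j * f i)) + (\<Sum>i\<in>V. \<Sum>j\<in>V. ?Q i j * (g j * f j)))"
    unfolding energy_def sum_subtractf[symmetric] sum.distrib[symmetric]
    by (intro arg_cong2[of _ _ _ _ "(*)"] sum.cong refl) (simp add: algebra_simps)
  also have "\<dots> = (\<Sum>i\<in>V. \<Sum>j\<in>V. ?Q i j * (g i * f i)) - (\<Sum>i\<in>V. \<Sum>j\<in>V. ?Q i j * (g i * f j))"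
    by (simp add: flip[of "\<lambda>i j. g j * f i"] flip[of "\<lambda>i j. g j * f j"])
  also have "\<dots> = mean (\<lambda>i. g i * defect f i)"
    unfolding row mean_def sum_subtractf[symmetric] defect_def
    by (intro sum.cong refl) (simp add: algebra_simps sum_distrib_left)
  finally show ?thesis ..
qed

lemma mean_defect: "mean (defect f) = 0"
  using Green[of "\<lambda>_. 1" f] by (simp add: energy_def)

lemma energy_Cauchy_Schwarz: "(energy g f)\<^sup>2 \<le> energy g g * energy f f"
  using double_sum_Cauchy_Schwarz[of "\<lambda>i j. g i - g j" "\<lambda>i j. f i - f j"]
  by (simp add: energy_def power2_eq_square)

lemma energy_shift: "energy (\<lambda>i. c - f i) (\<lambda>i. c - f i) = energy f f"
proof -
  have "(c - f i - (c - f j)) * (c - f i - (c - f j)) = (f i - f j) * (f i - f j)" for i j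
    by algebra
  then show ?thesis
    by (simp only: energy_def)
qed

lemma mean_shift: "mean (\<lambda>i. c - f i) = c - mean f"
proof -
  have "mean (\<lambda>i. c - f i) = c * (\<Sum>i\<in>V. \<pi> i) - mean f"
    by (simp add: mean_def algebra_simps sum_subtractf sum_distrib_left)
  then show ?thesis by (simp add: sum_\<pi>)
qed

text \<open>
The expected hitting time of \<open>j\<close> from \<open>i\<close>, as the sum of the tail probabilities. It is a real
number only because the series converges, which follows from the spectral gap below.
\<close>

definition hit :: "'a \<Rightarrow> 'a \<Rightarrow> real" where
  "hit j i = (if i = j then 0 else \<Sum>t. survival K (V - {j}) t i)"

end

locale chain_with_gap = reversible_chain +
  fixes \<gamma> :: real
  assumes \<gamma>_pos: "0 < \<gamma>"
    and Poincare: "mean f = 0 \<Longrightarrow> \<gamma> * mean (\<lambda>i. (f i)\<^sup>2) \<le> energy f f"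
begin

lemma variance_le_energy: "\<gamma> * mean (\<lambda>i. (mean f - f i)\<^sup>2) \<le> energy f f"
  using Poincare[of "\<lambda>i. mean f - f i"] by (simp add: energy_shift mean_shift)

lemma mean_square_ge: "j \<in> V \<Longrightarrow> \<pi> j * (f j)\<^sup>2 \<le> mean (\<lambda>i. (f i)\<^sup>2)"
  unfolding mean_def using finite_V \<pi>_pos
  by (intro member_le_sum[of j V "\<lambda>i. \<pi> i * (f i)\<^sup>2"]) (auto simp: less_imp_le)

text \<open>
The partial sums \<open>U\<close> satisfy \<open>(I - P) U \<le> 1\<close> away from \<open>j\<close> and vanish at \<open>j\<close>, so the energy of \<open>U\<close> is
at most its mean \<open>m\<close>. On the other hand \<open>U\<close> deviates by \<open>m\<close> from its mean at \<open>j\<close>, so the Poincare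
inequality bounds the energy from below by \<open>\<gamma> \<pi>\<^sub>j m\<^sup>2\<close>. Hence \<open>m\<close> stays bounded as \<open>T\<close> grows.
\<close>

lemma survival_sums_bounded:
  assumes "j \<in> V" "i \<in> V" "i \<noteq> j"
  shows "(\<Sum>t<T. survival K (V - {j}) t i) \<le> 1 / (\<gamma> * \<pi> j * \<pi> i)"
proof -
  define U where "U i = (if i = j then 0 else \<Sum>t<T. survival K (V - {j}) t i)" for i
  have U_nonneg: "0 \<le> U i" for i
    by (auto simp: U_def intro!: sum_nonneg survival_nonneg)
  have defect_U: "U i * defect U i \<le> U i" for i
  proof (cases "i = j")
    case False
    have "(\<Sum>k\<in>V. pmf (K i) k * U k) = (\<Sum>k\<in>V - {j}. pmf (K i) k * U k)"
      using finite_V by (intro sum.mono_neutral_right) (auto simp: U_def)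
    also have "\<dots> = (\<Sum>k\<in>V - {j}. \<Sum>t<T. pmf (K i) k * survival K (V - {j}) t k)"
      by (intro sum.cong refl) (auto simp: U_def sum_distrib_left)
    also have "\<dots> = (\<Sum>t<T. survival K (V - {j}) (Suc t) i)"
      by (subst sum.swap) simp
    also have "\<dots> = U i + survival K (V - {j}) T i - 1"
      using False sum.lessThan_Suc_shift[of "\<lambda>t. survival K (V - {j}) t i" T]
      by (simp add: U_def)
    finally have "defect U i \<le> 1"
      using survival_nonneg[of K "V - {j}" T i] by (simp add: defect_def)
    then show ?thesis
      using U_nonneg[of i] by (simp add: mult_left_le)
  qed (simp add: U_def)
  have mean_nonneg: "0 \<le> mean U"
    using \<pi>_pos U_nonneg by (auto simp: mean_def less_imp_le intro!: sum_nonneg)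
  have "energy U U \<le> mean U"
    unfolding Green[symmetric] unfolding mean_def
    using \<pi>_pos defect_U by (intro sum_mono mult_left_mono) (auto simp: less_imp_le)
  have "\<gamma> * (\<pi> j * (mean U)\<^sup>2) \<le> \<gamma> * mean (\<lambda>i. (mean U - U i)\<^sup>2)"
    using mean_square_ge[OF assms(1), of "\<lambda>i. mean U - U i"] \<gamma>_pos by (simp add: U_def)
  also have "\<dots> \<le> mean U"
    using variance_le_energy[of U] \<open>energy U U \<le> mean U\<close> by linarith
  finally have "mean U * (\<gamma> * \<pi> j * mean U) \<le> mean U * 1"
    by (simp add: power2_eq_square mult_ac)
  then have "\<gamma> * \<pi> j * mean U \<le> 1"
    using mean_nonneg by (cases "mean U = 0") auto
  moreover have "\<pi> i * U i \<le> mean U"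
    unfolding mean_def using finite_V \<pi>_pos U_nonneg assms
    by (intro member_le_sum[of i V "\<lambda>i. \<pi> i * U i"]) (auto simp: less_imp_le)
  then have "\<gamma> * \<pi> j * (\<pi> i * U i) \<le> \<gamma> * \<pi> j * mean U"
    using \<gamma>_pos \<pi>_pos[OF assms(1)] by (intro mult_left_mono) auto
  ultimately have "\<gamma> * \<pi> j * (\<pi> i * U i) \<le> 1"
    by linarith
  then show ?thesis
    using \<gamma>_pos \<pi>_pos[OF assms(1)] \<pi>_pos[OF assms(2)] assms(3)
    by (simp add: U_def field_simps)
qed

lemma summable_survival:
  assumes "j \<in> V" "i \<in> V" "i \<noteq> j"
  shows "summable (\<lambda>t. survival K (V - {j}) t i)"
  using survival_nonneg survival_sums_bounded[OF assms] by (rule summableI_nonneg_bounded)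

lemma hit_nonneg: "j \<in> V \<Longrightarrow> i \<in> V \<Longrightarrow> 0 \<le> hit j i"
  by (auto simp: hit_def intro!: suminf_nonneg summable_survival survival_nonneg)

text \<open>
Away from \<open>j\<close> this is the first-step equation \<open>h = 1 + P h\<close>. The value at \<open>j\<close>, which expresses
Kac's formula for the return time, is forced because \<open>I - P\<close> has mean zero.
\<close>

lemma defect_hit:
  assumes j: "j \<in> V" and i: "i \<in> V"
  shows "defect (hit j) i = 1 - of_bool (i = j) / \<pi> j"
proof -
  have away: "defect (hit j) i = 1" if i: "i \<in> V" "i \<noteq> j" for i
  proof -
    have "(\<Sum>k\<in>V. pmf (K i) k * hit j k) = (\<Sum>k\<in>V - {j}. pmf (K i) k * hit j k)"
      using finite_V by (intro sum.mono_neutral_right) (auto simp: hit_def)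
    also have "\<dots> = (\<Sum>k\<in>V - {j}. \<Sum>t. pmf (K i) k * survival K (V - {j}) t k)"
      using j by (intro sum.cong refl) (auto simp: hit_def suminf_mult summable_survival)
    also have "\<dots> = (\<Sum>t. survival K (V - {j}) (Suc t) i)"
      using j by (subst suminf_sum[symmetric]) (auto intro!: summable_mult summable_survival)
    also have "\<dots> = hit j i - 1"
      using suminf_split_head[OF summable_survival[OF j i]] i by (simp add: hit_def)
    finally show ?thesis by (simp add: defect_def)
  qed
  have "0 = mean (defect (hit j))"
    by (simp add: mean_defect)
  also have "\<dots> = \<pi> j * defect (hit j) j + (\<Sum>i\<in>V - {j}. \<pi> i * defect (hit j) i)"
    unfolding mean_def using finite_V j by (intro sum.remove)
  also have "(\<Sum>i\<in>V - {j}. \<pi> i * defect (hit j) i) = (\<Sum>i\<in>V - {j}. \<pi> i)"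
    by (intro sum.cong) (auto simp: away)
  also have "\<dots> = 1 - \<pi> j"
    using finite_V j sum.remove[of V j \<pi>] by (simp add: sum_\<pi>)
  finally have "defect (hit j) j = 1 - 1 / \<pi> j"
    using \<pi>_pos[OF j] by (simp add: field_simps)
  with away i show ?thesis by simp
qed

text \<open>
Hitting times represent, with respect to the Dirichlet form, the functional that compares a
function's mean with its value at the target. For \<open>g = hit j\<close> this identifies the energy of \<open>hit j\<close>
as its mean, and for the indicator of \<open>j\<close> it makes Cauchy--Schwarz a lower bound for that mean.
\<close>

lemma energy_hit:
  assumes j: "j \<in> V"
  shows "energy g (hit j) = mean g - g j"
proof -
  have "energy g (hit j) = (\<Sum>i\<in>V. \<pi> i * g i - of_bool (i = j) * g j)"
    unfolding Green[symmetric] unfolding mean_def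
    using \<pi>_pos[OF j] by (intro sum.cong refl) (auto simp: defect_hit j field_simps)
  also have "\<dots> = mean g - (\<Sum>i\<in>V. of_bool (i = j)) * g j"
    by (simp add: mean_def sum_subtractf sum_distrib_right)
  finally show ?thesis
    using finite_V j by (simp add: of_bool_def)
qed

lemma energy_hit_self: "j \<in> V \<Longrightarrow> energy (hit j) (hit j) = mean (hit j)"
  by (simp add: energy_hit hit_def)

text \<open>
Cauchy--Schwarz for the Dirichlet form between \<open>hit j\<close>, whose energy is its mean, and the
indicator of \<open>j\<close>, whose energy is at most \<open>\<pi>\<^sub>j\<close>, gives \<open>(1 - \<pi>\<^sub>j)\<^sup>2 \<le> \<pi>\<^sub>j m\<close> for \<open>m = mean (hit j)\<close>.
\<close>

lemma mean_hit_ge: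
  assumes j: "j \<in> V"
  shows "1 - 2 * \<pi> j \<le> \<pi> j * mean (hit j)"
proof -
  define \<delta> :: "'a \<Rightarrow> real" where "\<delta> i = of_bool (i = j)" for i
  have mean_\<delta>: "mean (\<lambda>i. \<delta> i * f i) = \<pi> j * f j" for f
    unfolding mean_def \<delta>_def using j finite_V by (simp add: of_bool_def if_distrib if_distribR cong: if_cong)
  have "energy \<delta> \<delta> \<le> \<pi> j"
  proof -
    have "(\<Sum>k\<in>V. pmf (K j) k * \<delta> k) \<ge> 0"
      by (intro sum_nonneg) (simp add: \<delta>_def)
    then have "\<pi> j * defect \<delta> j \<le> \<pi> j * 1"
      using \<pi>_pos[OF j] by (intro mult_left_mono) (auto simp: defect_def \<delta>_def)
    then show ?thesis
      using mean_\<delta>[of "defect \<delta>"] by (simp add: Green)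
  qed
  have "mean \<delta> = \<pi> j"
    using mean_\<delta>[of "\<lambda>_. 1"] by simp
  have "1 - 2 * \<pi> j \<le> (1 - \<pi> j)\<^sup>2"
    by (simp add: power2_diff)
  also have "(1 - \<pi> j)\<^sup>2 = (energy \<delta> (hit j))\<^sup>2"
    using \<open>mean \<delta> = \<pi> j\<close> by (simp add: energy_hit[OF j] power2_commute \<delta>_def)
  also have "\<dots> \<le> energy \<delta> \<delta> * mean (hit j)"
    using energy_Cauchy_Schwarz[of \<delta> "hit j"] by (simp add: energy_hit_self[OF j])
  also have "\<dots> \<le> \<pi> j * mean (hit j)"
    using \<open>energy \<delta> \<delta> \<le> \<pi> j\<close> \<pi>_pos hit_nonneg[OF j]
    by (intro mult_right_mono) (auto simp: mean_def less_imp_le intro!: sum_nonneg)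
  finally show ?thesis .
qed

text \<open>
With \<open>m = mean (hit j)\<close> and \<open>f = m - hit j\<close>, the equation for \<open>(I - P) f\<close> at \<open>j\<close> reads
\<open>\<pi>\<^sub>j m = 1 - \<pi>\<^sub>j + \<pi>\<^sub>j (P f)(j)\<close>, so \<open>\<pi>\<^sub>j m\<close> exceeds one only through the average of \<open>f\<close> over one step
from \<open>j\<close>. Cauchy--Schwarz separates this average into the two-step return probability at \<open>j\<close>,
which is at most \<open>\<rho>\<close>, and the variance of \<open>f\<close>, which is at most \<open>m / \<gamma>\<close> by the Poincare inequality.
\<close>

lemma mean_hit_quadratic:
  assumes j: "j \<in> V" and \<rho>: "\<And>k. k \<in> V \<Longrightarrow> pmf (K k) j \<le> \<rho>"
  assumes gt: "1 \<le> \<pi> j * mean (hit j)"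
  shows "(\<pi> j * mean (hit j) - 1)\<^sup>2 \<le> \<rho> / \<gamma> * (\<pi> j * mean (hit j))"
proof -
  define m where "m = mean (hit j)"
  define f where "f i = m - hit j i" for i
  \<comment> \<open>the energy of \<open>f\<close> is that of \<open>hit j\<close>, which is \<open>m\<close>\<close>
  have variance: "mean (\<lambda>i. (f i)\<^sup>2) \<le> m / \<gamma>"
    using variance_le_energy[of "hit j"] \<gamma>_pos
    by (simp add: f_def m_def energy_hit_self[OF j] field_simps)
  have \<rho>_nonneg: "0 \<le> \<rho>"
    using \<rho>[OF j] pmf_nonneg[of "K j" j] by linarith
  have "(\<Sum>k\<in>V. \<pi> j * pmf (K j) k * f k) = \<pi> j * (\<Sum>k\<in>V. pmf (K j) k) * m - \<pi> j * (\<Sum>k\<in>V. pmf (K j) k * hit j k)"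
    by (simp add: f_def algebra_simps sum_subtractf sum_distrib_left)
  also have "\<dots> = \<pi> j * m + \<pi> j * defect (hit j) j"
    by (simp add: sum_pmf_row[OF j] defect_def hit_def)
  also have "\<dots> = \<pi> j * m - (1 - \<pi> j)"
    using \<pi>_pos[OF j] by (simp add: defect_hit j field_simps)
  finally have x: "(\<Sum>k\<in>V. \<pi> j * pmf (K j) k * f k) = \<pi> j * m - (1 - \<pi> j)" .
  have "(\<pi> j * m - 1)\<^sup>2 \<le> (\<Sum>k\<in>V. \<pi> j * pmf (K j) k * f k)\<^sup>2"
    using gt \<pi>_pos[OF j] unfolding x m_def[symmetric] by (intro power_mono) auto
  also have "\<dots> = (\<Sum>k\<in>V. (\<pi> j * pmf (K j) k / sqrt (\<pi> k)) * (sqrt (\<pi> k) * f k))\<^sup>2"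
    using \<pi>_pos by (intro arg_cong[of _ _ "\<lambda>x. x\<^sup>2"] sum.cong) force+
  also have "\<dots> \<le> (\<Sum>k\<in>V. (\<pi> j * pmf (K j) k / sqrt (\<pi> k))\<^sup>2) * (\<Sum>k\<in>V. (sqrt (\<pi> k) * f k)\<^sup>2)"
    by (rule Cauchy_Schwarz_ineq_sum)
  also have "(\<Sum>k\<in>V. (sqrt (\<pi> k) * f k)\<^sup>2) = mean (\<lambda>i. (f i)\<^sup>2)"
    unfolding mean_def using \<pi>_pos by (intro sum.cong) (auto simp: power_mult_distrib less_imp_le)
  also have "(\<Sum>k\<in>V. (\<pi> j * pmf (K j) k / sqrt (\<pi> k))\<^sup>2) = (\<Sum>k\<in>V. \<pi> j * pmf (K j) k * pmf (K k) j)"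
  proof (intro sum.cong refl)
    fix k assume k: "k \<in> V"
    \<comment> \<open>reversibility turns one of the two equal factors into a step back to \<open>j\<close>\<close>
    have "(\<pi> j * pmf (K j) k / sqrt (\<pi> k))\<^sup>2 = (\<pi> j * pmf (K j) k) * (\<pi> j * pmf (K j) k) / \<pi> k"
      using \<pi>_pos[OF k] by (simp add: power2_eq_square)
    also have "\<dots> = (\<pi> j * pmf (K j) k) * (\<pi> k * pmf (K k) j) / \<pi> k"
      by (simp only: reversible[OF j k])
    finally show "(\<pi> j * pmf (K j) k / sqrt (\<pi> k))\<^sup>2 = \<pi> j * pmf (K j) k * pmf (K k) j"
      using \<pi>_pos[OF k] by simp
  qed
  also have "\<dots> * mean (\<lambda>i. (f i)\<^sup>2) \<le> (\<pi> j * \<rho>) * (m / \<gamma>)"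
  proof (intro mult_mono variance)
    have "(\<Sum>k\<in>V. \<pi> j * pmf (K j) k * pmf (K k) j) \<le> (\<Sum>k\<in>V. \<pi> j * pmf (K j) k * \<rho>)"
      using \<rho> \<pi>_pos[OF j] by (intro sum_mono mult_left_mono) auto
    also have "\<dots> = \<pi> j * \<rho> * (\<Sum>k\<in>V. pmf (K j) k)"
      by (simp add: sum_distrib_left mult_ac)
    finally show "(\<Sum>k\<in>V. \<pi> j * pmf (K j) k * pmf (K k) j) \<le> \<pi> j * \<rho>"
      by (simp add: sum_pmf_row[OF j])
    show "0 \<le> mean (\<lambda>i. (f i)\<^sup>2)"
      using \<pi>_pos by (auto simp: mean_def less_imp_le intro!: sum_nonneg)
  qed (use \<rho>_nonneg \<pi>_pos[OF j] in auto)
  finally show ?thesis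
    by (simp add: m_def mult_ac)
qed

text \<open>
The quadratic inequality fails beyond \<open>1 + \<epsilon>\<close>, because \<open>(x - 1)\<^sup>2 / x\<close> increases for \<open>x \<ge> 1\<close> and equals
\<open>\<epsilon>\<^sup>2 / (1 + \<epsilon>)\<close> at \<open>x = 1 + \<epsilon>\<close>.
\<close>

lemma mean_hit_le:
  assumes j: "j \<in> V" and \<rho>: "\<And>k. k \<in> V \<Longrightarrow> pmf (K k) j \<le> \<rho>"
    and \<epsilon>: "0 < \<epsilon>" "(1 + \<epsilon>) * \<rho> \<le> \<gamma> * \<epsilon>\<^sup>2"
  shows "\<pi> j * mean (hit j) \<le> 1 + \<epsilon>"
proof (rule ccontr)
  define s where "s = \<pi> j * mean (hit j) - (1 + \<epsilon>)"
  assume "\<not> \<pi> j * mean (hit j) \<le> 1 + \<epsilon>"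
  then have s: "0 < s" "\<pi> j * mean (hit j) = 1 + \<epsilon> + s"
    by (auto simp: s_def)
  have "(\<epsilon> + s)\<^sup>2 \<le> \<rho> / \<gamma> * (1 + \<epsilon> + s)"
    using mean_hit_quadratic[OF j \<rho>] s \<epsilon>(1) by (simp add: add_ac)
  then have "(1 + \<epsilon>) * (\<epsilon> + s)\<^sup>2 \<le> (1 + \<epsilon>) * (\<rho> / \<gamma> * (1 + \<epsilon> + s))"
    using \<epsilon>(1) by (intro mult_left_mono) auto
  also have "\<dots> = ((1 + \<epsilon>) * \<rho>) / \<gamma> * (1 + \<epsilon> + s)"
    by simp
  also have "\<dots> \<le> \<epsilon>\<^sup>2 * (1 + \<epsilon> + s)"
    using \<epsilon> \<gamma>_pos s by (intro mult_right_mono) (auto simp: field_simps)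
  finally have "2 * \<epsilon> * s + \<epsilon>\<^sup>2 * s + s\<^sup>2 * (1 + \<epsilon>) \<le> 0"
    by (simp add: power2_eq_square algebra_simps)
  moreover have "0 < 2 * \<epsilon> * s + \<epsilon>\<^sup>2 * s + s\<^sup>2 * (1 + \<epsilon>)"
    using \<epsilon>(1) s(1) by (intro add_pos_pos) auto
  ultimately show False by linarith
qed

text \<open>
The random target lemma: the hitting time averaged over a stationary target is a harmonic function
of the starting point, since \<open>\<Sum>\<^sub>j \<pi>\<^sub>j (1 - \<delta>\<^sub>i\<^sub>j / \<pi>\<^sub>j) = 0\<close>. A harmonic function has zero energy and is
constant by the Poincare inequality, hence equal to its own mean.
\<close>

lemma random_target:
  assumes i: "i \<in> V"
  shows "(\<Sum>j\<in>V. \<pi> j * hit j i) = (\<Sum>j\<in>V. \<pi> j * mean (hit j))"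
proof -
  define g where "g i = (\<Sum>j\<in>V. \<pi> j * hit j i)" for i
  have harmonic: "defect g i = 0" if i: "i \<in> V" for i
  proof -
    have "(\<Sum>k\<in>V. pmf (K i) k * g k) = (\<Sum>j\<in>V. \<pi> j * (\<Sum>k\<in>V. pmf (K i) k * hit j k))"
      unfolding g_def sum_distrib_left by (subst sum.swap) (simp add: mult_ac)
    then have "defect g i = (\<Sum>j\<in>V. \<pi> j * defect (hit j) i)"
      by (simp add: defect_def g_def sum_subtractf right_diff_distrib)
    also have "\<dots> = (\<Sum>j\<in>V. \<pi> j - of_bool (i = j))"
      using \<pi>_pos by (intro sum.cong refl) (force simp: defect_hit i algebra_simps)
    also have "\<dots> = 0"
      using i finite_V by (simp add: sum_subtractf sum_\<pi> of_bool_def)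
    finally show ?thesis .
  qed
  have "energy g g = 0"
    unfolding Green[symmetric] by (simp add: mean_def harmonic)
  then have "mean (\<lambda>i. (mean g - g i)\<^sup>2) \<le> 0"
    using variance_le_energy[of g] \<gamma>_pos by (simp add: mult_le_0_iff)
  then have "\<pi> i * (mean g - g i)\<^sup>2 \<le> 0"
    using mean_square_ge[OF i, of "\<lambda>i. mean g - g i"] by linarith
  then have "g i = mean g"
    using \<pi>_pos[OF i] by (simp add: mult_le_0_iff)
  also have "mean g = (\<Sum>j\<in>V. \<pi> j * mean (hit j))"
    unfolding mean_def g_def sum_distrib_left by (subst sum.swap) (simp add: mult_ac)
  finally show ?thesis
    by (simp add: g_def)
qed

theorem average_hit_bounds:
  assumes i: "i \<in> V"
    and \<rho>: "\<And>k j. k \<in> V \<Longrightarrow> j \<in> V \<Longrightarrow> pmf (K k) j \<le> \<rho>"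
    and \<epsilon>: "0 < \<epsilon>" "(1 + \<epsilon>) * \<rho> \<le> \<gamma> * \<epsilon>\<^sup>2"
  shows "real (card V) - 2 \<le> (\<Sum>j\<in>V. \<pi> j * hit j i)"
    and "(\<Sum>j\<in>V. \<pi> j * hit j i) \<le> (1 + \<epsilon>) * real (card V)"
proof -
  have "(\<Sum>j\<in>V. 1 - 2 * \<pi> j) \<le> (\<Sum>j\<in>V. \<pi> j * hit j i)"
    unfolding random_target[OF i] by (intro sum_mono mean_hit_ge)
  then show "real (card V) - 2 \<le> (\<Sum>j\<in>V. \<pi> j * hit j i)"
    by (simp add: sum_subtractf sum_\<pi> flip: sum_distrib_left)
  have "(\<Sum>j\<in>V. \<pi> j * hit j i) \<le> (\<Sum>j\<in>V. 1 + \<epsilon>)"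
    unfolding random_target[OF i] using \<epsilon> by (intro sum_mono mean_hit_le[OF _ \<rho>])
  then show "(\<Sum>j\<in>V. \<pi> j * hit j i) \<le> (1 + \<epsilon>) * real (card V)"
    by (simp add: mult.commute)
qed

end

section \<open>Expected hitting times on trajectory space\<close>

lemma sets_chain_law: "sets (chain_law K x) = sets (PiM UNIV (\<lambda>_. count_space UNIV))"
proof -
  interpret IT: Ionescu_Tulcea "chain_kernel K x" "\<lambda>_. count_space UNIV"
    by (rule Ionescu_Tulcea_chain_kernel)
  show ?thesis
    unfolding chain_law_def by (rule IT.PF.sets_lim)
qed

lemma space_chain_law: "space (chain_law K x) = UNIV"
  using sets_eq_imp_space_eq[OF sets_chain_law[of K x]] by (simp add: space_PiM)

lemma measurable_coordinate: "(\<lambda>\<omega>. \<omega> k) \<in> chain_law K x \<rightarrow>\<^sub>M count_space UNIV"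
  unfolding measurable_cong_sets[OF sets_chain_law refl]
  by (rule measurable_component_singleton) simp

lemma sets_coordinate: "{\<omega>. P (\<omega> k)} \<in> sets (chain_law K x)"
  using measurable_sets[OF measurable_coordinate, of "{y. P y}" k K x]
  by (simp add: space_chain_law vimage_def)

lemma sets_bounded_path:
  "{\<omega>. \<forall>k\<le>n. P k (\<omega> k)} \<in> sets (chain_law K x)"
proof -
  have "{\<omega>. \<forall>k\<le>n. P k (\<omega> k)} = (\<Inter>k\<in>{..n}. {\<omega>. P k (\<omega> k)})"
    by auto
  then show ?thesis
    by (auto intro!: sets.finite_INT sets_coordinate)
qed

lemma prob_space_chain_law: "prob_space (chain_law K x)"
proof
  interpret IT: Ionescu_Tulcea "chain_kernel K x" "\<lambda>_. count_space UNIV"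
    by (rule Ionescu_Tulcea_chain_kernel)
  let ?X = "space (PiM {} (\<lambda>_::nat. count_space UNIV :: 'a measure))"
  have "emeasure (chain_law K x) (IT.PF.emb UNIV {} ?X) = emeasure (IT.CI {}) ?X"
    unfolding chain_law_def by (rule IT.lim) auto
  also have "\<dots> = 1"
    using prob_space.emeasure_space_1[OF IT.PF.prob_space_P[of "{}"]] by (simp add: IT.PF.space_P)
  also have "IT.PF.emb UNIV {} ?X = space (chain_law K x)"
    by (auto simp: prod_emb_def space_PiM space_chain_law)
  finally show "emeasure (chain_law K x) (space (chain_law K x)) = 1" .
qed

lemma AE_start: "AE \<omega> in chain_law K x. \<omega> 0 = x"
proof -
  interpret prob_space "chain_law K x"
    by (rule prob_space_chain_law)
  have "emeasure (chain_law K x) {\<omega>. \<omega> 0 = x} = 1"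
    using emeasure_chain_law[of K x 0 "\<lambda>_. x"] by simp
  then have "prob {\<omega>. \<omega> 0 = x} = 1"
    by (simp add: measure_def)
  then show ?thesis
    using prob_eq_1[OF sets_coordinate[of "\<lambda>y. y = x" 0 K x]] by simp
qed

text \<open>
The law of the chain is known on paths that are prescribed up to a time. Prescribing the next
state and summing over its finitely many values in \<open>B\<close> turns a condition \<open>\<omega> k \<in> B\<close> into a
prescribed path that is one step longer, so induction on \<open>t\<close> works for arbitrary prefixes.
\<close>

lemma emeasure_path_then_stay:
  assumes B: "finite B" and a: "a 0 = x"
  shows "emeasure (chain_law K x) {\<omega>. (\<forall>k\<le>n. \<omega> k = a k) \<and> (\<forall>k\<in>{n<..n + t}. \<omega> k \<in> B)} =
    ennreal ((\<Prod>k<n. pmf (K (a k)) (a (Suc k))) * survival K B t (a n))"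
  using a
proof (induction t arbitrary: n a)
  case 0
  then show ?case
    using emeasure_chain_law[of K x n a] by (simp add: prod_ennreal)
next
  case (Suc t)
  define A where "A y = {\<omega>. (\<forall>k\<le>Suc n. \<omega> k = (a(Suc n := y)) k) \<and>
    (\<forall>k\<in>{Suc n<..Suc n + t}. \<omega> k \<in> B)}" for y
  have A_iff: "\<omega> \<in> A y \<longleftrightarrow> (\<forall>k\<le>n. \<omega> k = a k) \<and> \<omega> (Suc n) = y \<and>
      (\<forall>k\<in>{Suc n<..Suc n + t}. \<omega> k \<in> B)" for \<omega> y
  proof -
    have "(\<forall>k\<le>Suc n. \<omega> k = (a(Suc n := y)) k) \<longleftrightarrow> (\<forall>k\<le>n. \<omega> k = a k) \<and> \<omega> (Suc n) = y"
      unfolding atMost_iff[symmetric] Ball_def[symmetric] atMost_Suc by auto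
    then show ?thesis
      by (simp only: A_def mem_Collect_eq) blast
  qed
  have tail: "{n<..n + Suc t} = insert (Suc n) {Suc n<..Suc n + t}"
    by auto
  have split: "{\<omega>. (\<forall>k\<le>n. \<omega> k = a k) \<and> (\<forall>k\<in>{n<..n + Suc t}. \<omega> k \<in> B)} = (\<Union>y\<in>B. A y)"
    unfolding tail ball_simps by (intro set_eqI) (simp only: UN_iff A_iff mem_Collect_eq, blast)
  have "A y \<in> sets (chain_law K x)" for y
  proof -
    have "A y = {\<omega>. \<forall>k\<le>Suc n. \<omega> k = (a(Suc n := y)) k} \<inter>
        {\<omega>. \<forall>k\<le>Suc n + t. Suc n < k \<longrightarrow> \<omega> k \<in> B}"
      unfolding A_def by (intro set_eqI) (simp only: Int_iff mem_Collect_eq greaterThanAtMost_iff Ball_def, blast)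
    then show ?thesis
      using sets_bounded_path[of "Suc n" "\<lambda>k z. z = (a(Suc n := y)) k" K x]
        sets_bounded_path[of "Suc n + t" "\<lambda>k z. Suc n < k \<longrightarrow> z \<in> B" K x] by simp
  qed
  moreover have "disjoint_family_on A B"
    by (auto simp: disjoint_family_on_def A_iff simp del: greaterThanAtMost_iff)
  ultimately have "emeasure (chain_law K x) (\<Union>y\<in>B. A y) = (\<Sum>y\<in>B. emeasure (chain_law K x) (A y))"
    using B by (intro sum_emeasure[symmetric]) auto
  also have "\<dots> = (\<Sum>y\<in>B. ennreal ((\<Prod>k<n. pmf (K (a k)) (a (Suc k))) * (pmf (K (a n)) y * survival K B t y)))"
  proof (intro sum.cong refl)
    fix y
    have "(\<Prod>k<Suc n. pmf (K ((a(Suc n := y)) k)) ((a(Suc n := y)) (Suc k)))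
       = (\<Prod>k<n. pmf (K (a k)) (a (Suc k))) * pmf (K (a n)) y"
      unfolding prod.lessThan_Suc by (intro arg_cong2[of _ _ _ _ "(*)"] prod.cong) auto
    then show "emeasure (chain_law K x) (A y) =
      ennreal ((\<Prod>k<n. pmf (K (a k)) (a (Suc k))) * (pmf (K (a n)) y * survival K B t y))"
      unfolding A_def using Suc.prems by (subst Suc.IH) (simp_all add: mult_ac)
  qed
  also have "\<dots> = ennreal ((\<Prod>k<n. pmf (K (a k)) (a (Suc k))) * survival K B (Suc t) (a n))"
    by (subst sum_ennreal) (auto intro!: mult_nonneg_nonneg prod_nonneg survival_nonneg simp: sum_distrib_left)
  finally show ?case
    unfolding split .
qed

lemma sets_stay: "{\<omega>. \<forall>k\<in>{0<..t}. \<omega> k \<in> B} \<in> sets (chain_law K x)"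
proof -
  have "{\<omega>. \<forall>k\<in>{0<..t}. \<omega> k \<in> B} = {\<omega>. \<forall>k\<le>t. 0 < k \<longrightarrow> \<omega> k \<in> B}"
    by auto
  then show ?thesis
    using sets_bounded_path[of t "\<lambda>k y. 0 < k \<longrightarrow> y \<in> B" K x] by simp
qed

lemma emeasure_stay:
  assumes "finite B"
  shows "emeasure (chain_law K x) {\<omega>. \<forall>k\<in>{0<..t}. \<omega> k \<in> B} = ennreal (survival K B t x)"
proof -
  have "{\<omega>. \<omega> 0 = x \<and> (\<forall>k\<in>{0<..t}. \<omega> k \<in> B)}
      = {\<omega>. \<omega> 0 = x} \<inter> {\<omega>. \<forall>k\<in>{0<..t}. \<omega> k \<in> B}"
    by auto
  then have meas: "{\<omega>. \<omega> 0 = x \<and> (\<forall>k\<in>{0<..t}. \<omega> k \<in> B)} \<in> sets (chain_law K x)"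
    using sets_stay[of t B K x] sets_coordinate[of "\<lambda>y. y = x" 0 K x] by auto
  have "emeasure (chain_law K x) {\<omega>. \<forall>k\<in>{0<..t}. \<omega> k \<in> B} =
      emeasure (chain_law K x) {\<omega>. \<omega> 0 = x \<and> (\<forall>k\<in>{0<..t}. \<omega> k \<in> B)}"
    using AE_start[of x K] meas sets_stay[of t B K x] by (intro emeasure_eq_AE) auto
  also have "\<dots> = ennreal (survival K B t x)"
    using emeasure_path_then_stay[OF assms, of "\<lambda>_. x" x K 0 t] by simp
  finally show ?thesis .
qed

lemma survival_closed:
  assumes "finite V" "\<And>i. i \<in> V \<Longrightarrow> set_pmf (K i) \<subseteq> V" "x \<in> V"
  shows "survival K V t x = 1"
  using assms(3)
proof (induction t arbitrary: x)
  case (Suc t)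
  then show ?case
    using sum_pmf_eq_1[OF assms(1) assms(2)[OF Suc.prems]] by simp
qed simp

lemma AE_stay_closed:
  assumes "finite V" "\<And>i. i \<in> V \<Longrightarrow> set_pmf (K i) \<subseteq> V" "x \<in> V"
  shows "AE \<omega> in chain_law K x. \<forall>k. \<omega> k \<in> V"
proof -
  interpret prob_space "chain_law K x"
    by (rule prob_space_chain_law)
  have "AE \<omega> in chain_law K x. \<forall>k\<in>{0<..t}. \<omega> k \<in> V" for t
  proof -
    have "prob {\<omega>. \<forall>k\<in>{0<..t}. \<omega> k \<in> V} = 1"
      using emeasure_stay[OF assms(1), of K x t] survival_closed[of V K x t] assms
      by (simp add: measure_def)
    then show ?thesis
      using prob_eq_1[OF sets_stay[of t V K x]] by simp
  qed
  then have "AE \<omega> in chain_law K x. \<forall>t. \<forall>k\<in>{0<..t}. \<omega> k \<in> V"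
    by (simp add: AE_all_countable)
  then show ?thesis
    using AE_start[of x K]
  proof eventually_elim
    case (elim \<omega>)
    show ?case
    proof
      fix k
      show "\<omega> k \<in> V"
      proof (cases "k = 0")
        case False
        then have "k \<in> {0<..k}"
          by simp
        with elim show ?thesis
          by blast
      qed (use elim assms(3) in simp)
    qed
  qed
qed

lemma hitting_time_eq_suminf:
  "hitting_time j \<omega> = (\<Sum>t. of_bool (\<forall>k\<le>t. \<omega> k \<noteq> j))"
proof (cases "\<exists>t. \<omega> t = j")
  case True
  define T where "T = (LEAST t. \<omega> t = j)"
  have T: "\<omega> T = j" "\<And>t. \<omega> t = j \<Longrightarrow> T \<le> t"
    using True by (auto simp: T_def intro: LeastI Least_le)
  have "hitting_time j \<omega> = of_nat T"
    unfolding hitting_time_def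
  proof (rule antisym)
    show "(INF t\<in>{t. \<omega> t = j}. of_nat t) \<le> (of_nat T :: ennreal)"
      using T by (intro INF_lower) auto
    show "(of_nat T :: ennreal) \<le> (INF t\<in>{t. \<omega> t = j}. of_nat t)"
      using T by (intro INF_greatest) auto
  qed
  moreover have "(\<forall>k\<le>t. \<omega> k \<noteq> j) \<longleftrightarrow> t < T" for t
    using T by (metis less_le_trans linorder_not_less order_refl)
  then have "(\<Sum>t. of_bool (\<forall>k\<le>t. \<omega> k \<noteq> j) :: ennreal) = (\<Sum>t<T. 1)"
    by (subst suminf_finite[of "{..<T}"]) auto
  ultimately show ?thesis by simp
next
  case False
  have "(\<Sum>t. ennreal 1) = \<top>"
    using summable_suminf_not_top[of "\<lambda>_. 1"] by (auto simp: summable_const_iff)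
  with False show ?thesis
    by (simp add: hitting_time_def)
qed

text \<open>
The expectation of a time with values in the natural numbers is the sum of its tail probabilities.
The trajectories almost surely stay in the finite closed set \<open>V\<close>, so that avoiding \<open>j\<close> means staying
in \<open>V - {j}\<close>, an event whose probability involves only finite sums.
\<close>

theorem expectation_hitting_time:
  assumes V: "finite V" "\<And>i. i \<in> V \<Longrightarrow> set_pmf (K i) \<subseteq> V" "x \<in> V"
  shows "(\<integral>\<^sup>+\<omega>. hitting_time j \<omega> \<partial>chain_law K x) =
    (if x = j then 0 else \<Sum>t. ennreal (survival K (V - {j}) t x))"
proof (cases "x = j")
  case True
  have "(\<integral>\<^sup>+\<omega>. hitting_time j \<omega> \<partial>chain_law K x) = (\<integral>\<^sup>+\<omega>. 0 \<partial>chain_law K x)"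
  proof (rule nn_integral_cong_AE)
    show "AE \<omega> in chain_law K x. hitting_time j \<omega> = 0"
      using AE_start[of x K]
    proof eventually_elim
      case (elim \<omega>)
      then have "hitting_time j \<omega> \<le> of_nat 0"
        unfolding hitting_time_def using True by (intro INF_lower) auto
      then show ?case by simp
    qed
  qed
  then show ?thesis using True by simp
next
  case False
  have stay: "AE \<omega> in chain_law K x. \<forall>k. \<omega> k \<in> V"
    by (rule AE_stay_closed) (use V in auto)
  have "(\<integral>\<^sup>+\<omega>. hitting_time j \<omega> \<partial>chain_law K x) =
      (\<integral>\<^sup>+\<omega>. (\<Sum>t. indicator {\<omega>. \<forall>k\<le>t. \<omega> k \<noteq> j} \<omega>) \<partial>chain_law K x)"
    by (simp add: hitting_time_eq_suminf indicator_def)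
  also have "\<dots> = (\<Sum>t. emeasure (chain_law K x) {\<omega>. \<forall>k\<le>t. \<omega> k \<noteq> j})"
    using sets_bounded_path[of _ "\<lambda>_ y. y \<noteq> j"] by (subst nn_integral_suminf) auto
  also have "\<dots> = (\<Sum>t. ennreal (survival K (V - {j}) t x))"
  proof (intro suminf_cong)
    fix t
    have "emeasure (chain_law K x) {\<omega>. \<forall>k\<le>t. \<omega> k \<noteq> j} =
        emeasure (chain_law K x) {\<omega>. \<forall>k\<in>{0<..t}. \<omega> k \<in> V - {j}}"
    proof (rule emeasure_eq_AE)
      show "AE \<omega> in chain_law K x. \<omega> \<in> {\<omega>. \<forall>k\<le>t. \<omega> k \<noteq> j} \<longleftrightarrow> \<omega> \<in> {\<omega>. \<forall>k\<in>{0<..t}. \<omega> k \<in> V - {j}}"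
        using AE_start[of x K] stay
      proof eventually_elim
        case (elim \<omega>)
        have "\<omega> k \<noteq> j" if "\<forall>k\<in>{0<..t}. \<omega> k \<noteq> j" "k \<le> t" for k
          using that elim False by (cases "k = 0") auto
        with elim show ?case by auto
      qed
    qed (rule sets_bounded_path[of t "\<lambda>_ y. y \<noteq> j"], rule sets_stay)
    then show "emeasure (chain_law K x) {\<omega>. \<forall>k\<le>t. \<omega> k \<noteq> j} = ennreal (survival K (V - {j}) t x)"
      using V(1) by (simp only: emeasure_stay finite_Diff)
  qed
  finally show ?thesis using False by simp
qed

section \<open>Random walk on expanding hypergraphs\<close>

text \<open>
The multiplicity of the edge \<open>{v, w}\<close> in the multigraph on which the walk is simple random walk.
\<close>

definition pair_weight :: "nat set set \<Rightarrow> nat \<Rightarrow> nat \<Rightarrow> real" where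
  "pair_weight E v w = (if v = w then 0 else real (card {e \<in> E. v \<in> e \<and> w \<in> e}))"

lemma finite_potential_edges: "finite (potential_edges d n)"
  unfolding potential_edges_def vertices_def
  by (rule finite_subset[of _ "Pow {1..n}"]) auto

lemma finite_hypergraph: "E \<subseteq> potential_edges d n \<Longrightarrow> finite E"
  using finite_potential_edges finite_subset by blast

lemma pmf_walk_step:
  assumes d: "2 \<le> d" and E: "E \<subseteq> potential_edges d n" and star: "{e \<in> E. v \<in> e} \<noteq> {}"
  shows "pmf (walk_step E v) w = pair_weight E v w / real (walk_degree d E v)"
proof -
  have fin: "finite {e \<in> E. v \<in> e}"
    using finite_hypergraph[OF E] by simp
  have step: "pmf (pmf_of_set (e - {v})) w = of_bool (v \<noteq> w \<and> w \<in> e) / real (d - 1)"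
    if "e \<in> E" "v \<in> e" for e
  proof -
    have e: "finite e" "card e = d"
      using that(1) E by (auto simp: potential_edges_def vertices_def dest: finite_subset)
    then have card: "card (e - {v}) = d - 1"
      using that(2) by simp
    then have "e - {v} \<noteq> {}"
      using d by (metis One_nat_def card.empty diff_is_0_eq not_less_eq_eq numeral_2_eq_2)
    then show ?thesis
      using e card by (auto simp: pmf_of_set indicator_def)
  qed
  have "pmf (walk_step E v) w
      = (\<Sum>e\<in>{e \<in> E. v \<in> e}. pmf (pmf_of_set (e - {v})) w) / real (card {e \<in> E. v \<in> e})"
    unfolding walk_step_def pmf_bind by (rule integral_pmf_of_set[OF star fin])
  also have "(\<Sum>e\<in>{e \<in> E. v \<in> e}. pmf (pmf_of_set (e - {v})) w)
      = (\<Sum>e\<in>{e \<in> E. v \<in> e}. of_bool (v \<noteq> w \<and> w \<in> e)) / real (d - 1)"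
    unfolding sum_divide_distrib by (intro sum.cong refl step) auto
  also have "(\<Sum>e\<in>{e \<in> E. v \<in> e}. of_bool (v \<noteq> w \<and> w \<in> e) :: real) = pair_weight E v w"
  proof -
    have "{e \<in> E. v \<in> e} \<inter> {e. w \<in> e} = {e \<in> E. v \<in> e \<and> w \<in> e}"
      by auto
    then show ?thesis
      using fin by (simp add: pair_weight_def of_bool_def sum.If_cases)
  qed
  finally show ?thesis
    by (simp add: walk_degree_def mult.commute)
qed

lemma set_pmf_walk_step:
  assumes d: "2 \<le> d" and E: "E \<subseteq> potential_edges d n" and star: "{e \<in> E. v \<in> e} \<noteq> {}"
  shows "set_pmf (walk_step E v) \<subseteq> vertices n"
proof
  fix w assume "w \<in> set_pmf (walk_step E v)"
  then have "pair_weight E v w \<noteq> 0"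
    using pmf_walk_step[OF assms, of w] by (auto simp: set_pmf_iff)
  then have "{e \<in> E. v \<in> e \<and> w \<in> e} \<noteq> {}"
    unfolding pair_weight_def by (metis card.empty of_nat_0)
  then show "w \<in> vertices n"
    using E by (auto simp: potential_edges_def)
qed

text \<open>
The typical properties of the random hypergraph on which the hitting time estimate rests. Only
hyperedges that meet \<open>S\<close> in a single vertex are counted in the expansion, as these are easily
counted and already make up a constant proportion of the possible boundary when \<open>S\<close> contains at
most half of the vertices.
\<close>

locale expanding_hypergraph =
  fixes d n :: nat and E :: "nat set set" and \<kappa> \<Delta> \<eta> :: real
  assumes d: "2 \<le> d" and n: "2 \<le> n" and E: "E \<subseteq> potential_edges d n"
    and \<kappa>_pos: "0 < \<kappa>" and \<eta>_nonneg: "0 \<le> \<eta>"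
    and expansion: "S \<subseteq> vertices n \<Longrightarrow> 2 * card S \<le> n \<Longrightarrow>
      \<kappa> * real (card S) \<le> real (card {e \<in> E. card (e \<inter> S) = 1})"
    and degree_le: "i \<in> vertices n \<Longrightarrow> real (card {e \<in> E. i \<in> e}) \<le> \<Delta>"
    and codegree_le: "i \<in> vertices n \<Longrightarrow> j \<in> vertices n \<Longrightarrow> i \<noteq> j \<Longrightarrow>
      real (card {e \<in> E. i \<in> e \<and> j \<in> e}) \<le> \<eta>"
begin

lemma degree_ge:
  assumes "i \<in> vertices n"
  shows "\<kappa> \<le> real (card {e \<in> E. i \<in> e})"
proof -
  have "{e \<in> E. card (e \<inter> {i}) = 1} = {e \<in> E. i \<in> e}"
    by (auto simp: Int_insert_right)
  then show ?thesis
    using expansion[of "{i}"] assms n by simp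
qed

lemma star_nonempty:
  assumes "i \<in> vertices n"
  shows "{e \<in> E. i \<in> e} \<noteq> {}"
  using degree_ge[OF assms] \<kappa>_pos by (metis card.empty linorder_not_less of_nat_0)

lemma crossing_edge:
  assumes e: "e \<in> E" "card (e \<inter> S) = 1"
  obtains a b where "a \<in> e" "a \<in> S" "b \<in> e" "b \<in> vertices n - S"
proof -
  have "e \<subseteq> vertices n" "card e = d"
    using e(1) E by (auto simp: potential_edges_def)
  moreover obtain a where a: "e \<inter> S = {a}"
    using e(2) by (auto simp: card_1_singleton_iff)
  moreover have "\<not> e \<subseteq> S"
    using a \<open>card e = d\<close> e(2) d by (auto simp: Int_absorb2)
  ultimately show thesis
    using that[of a] by blast
qed

lemma hyperedge_leaves:
  assumes S: "S \<subseteq> vertices n" "S \<noteq> {}" "2 * card S \<le> n"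
  obtains e a b where "e \<in> E" "a \<in> e" "a \<in> S" "b \<in> e" "b \<in> vertices n - S"
proof -
  have "finite S"
    using S(1) by (rule finite_subset) (simp add: vertices_def)
  then have "0 < \<kappa> * real (card S)"
    using S(2) \<kappa>_pos by (simp add: card_gt_0_iff)
  then have "{e \<in> E. card (e \<inter> S) = 1} \<noteq> {}"
    using expansion[OF S(1,3)] by (metis card.empty linorder_not_less of_nat_0)
  then obtain e where e: "e \<in> E" "card (e \<inter> S) = 1"
    by auto
  show thesis
    using crossing_edge[OF e] that[OF e(1)] by blast
qed

text \<open>
If the set reached from \<open>v\<close> were not everything, then either it or its complement would be a small
set, and a hyperedge on its boundary would extend some chain beyond the reached set.
\<close>

lemma connected: "hconnected n E"
proof -
  define chain where "chain v w es \<longleftrightarrow> es \<noteq> [] \<and> set es \<subseteq> E \<and> v \<in> hd es \<and> w \<in> last es \<and>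
    successively (\<lambda>e f. e \<inter> f \<noteq> {}) es" for v w :: nat and es
  have "w = v \<or> (\<exists>es. chain v w es)" if v: "v \<in> vertices n" and w: "w \<in> vertices n" for v w
  proof (rule ccontr)
    assume unreachable: "\<not> (w = v \<or> (\<exists>es. chain v w es))"
    define R where "R = {u \<in> vertices n. u = v \<or> (\<exists>es. chain v u es)}"
    have step: "b \<in> R" if e: "e \<in> E" "a \<in> e" "a \<in> R" "b \<in> e" for e a b
    proof -
      have "b \<in> vertices n"
        using e(1,4) E by (auto simp: potential_edges_def)
      moreover have "\<exists>es. chain v b es"
      proof (cases "a = v")
        case True
        then have "chain v b [e]"
          using e by (simp add: chain_def)
        then show ?thesis ..
      next
        case False
        then obtain es where "chain v a es"
          using e(3) by (auto simp: R_def)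
        then have "chain v b (es @ [e])"
          using e by (auto simp: chain_def successively_append_iff)
        then show ?thesis ..
      qed
      ultimately show ?thesis
        by (simp add: R_def)
    qed
    have fin: "finite (vertices n)" and card_V: "card (vertices n) = n"
      by (simp_all add: vertices_def)
    have R: "R \<subseteq> vertices n" "v \<in> R" "w \<notin> R"
      using v unreachable by (auto simp: R_def)
    have "card R + card (vertices n - R) = n"
      using card_mono[OF fin R(1)] card_Diff_subset[of R "vertices n"] finite_subset[OF R(1) fin] R(1)
      by (simp add: card_V)
    then consider "2 * card R \<le> n" | "2 * card (vertices n - R) \<le> n"
      by linarith
    then show False
    proof cases
      case 1
      with R(1,2) show False
        using hyperedge_leaves[of R] step by blast
    next
      case 2
      with w R show False
        using hyperedge_leaves[of "vertices n - R"] step by blast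
    qed
  qed
  then show ?thesis
    unfolding hconnected_def chain_def by metis
qed

sublocale pair: weighted_graph "vertices n" "pair_weight E"
  by unfold_locales (auto simp: vertices_def pair_weight_def conj_commute)

lemma cut_ge:
  assumes S: "S \<subseteq> vertices n" "2 * card S \<le> n"
  shows "\<kappa> * real (card S) \<le> pair.cut S"
proof -
  let ?pairs = "S \<times> (vertices n - S)"
  have fin: "finite ?pairs"
    using finite_subset[OF S(1)] by (simp add: vertices_def)
  have "{e \<in> E. card (e \<inter> S) = 1} \<subseteq> (\<Union>x\<in>?pairs. {e \<in> E. fst x \<in> e \<and> snd x \<in> e})"
  proof
    fix e assume "e \<in> {e \<in> E. card (e \<inter> S) = 1}"
    then have e: "e \<in> E" "card (e \<inter> S) = 1"
      by auto
    then obtain a b where "a \<in> e" "a \<in> S" "b \<in> e" "b \<in> vertices n - S"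
      by (rule crossing_edge)
    with e(1) show "e \<in> (\<Union>x\<in>?pairs. {e \<in> E. fst x \<in> e \<and> snd x \<in> e})"
      by (intro UN_I[of "(a, b)"]) auto
  qed
  then have "card {e \<in> E. card (e \<inter> S) = 1} \<le> card (\<Union>x\<in>?pairs. {e \<in> E. fst x \<in> e \<and> snd x \<in> e})"
    using fin finite_hypergraph[OF E] by (intro card_mono) auto
  also have "\<dots> \<le> (\<Sum>x\<in>?pairs. card {e \<in> E. fst x \<in> e \<and> snd x \<in> e})"
    using fin by (rule card_UN_le)
  finally have "\<kappa> * real (card S) \<le> (\<Sum>x\<in>?pairs. real (card {e \<in> E. fst x \<in> e \<and> snd x \<in> e}))"
    using expansion[OF S] by (simp flip: of_nat_sum)
  also have "\<dots> = pair.cut S"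
    unfolding pair.cut_def sum.cartesian_product
    by (intro sum.cong) (auto simp: pair_weight_def)
  finally show ?thesis .
qed

lemma walk_degree_pos: "i \<in> vertices n \<Longrightarrow> 0 < walk_degree d E i"
  using star_nonempty[of i] finite_hypergraph[OF E] d by (auto simp: walk_degree_def card_gt_0_iff)

lemma walk_degree_le: "i \<in> vertices n \<Longrightarrow> real (walk_degree d E i) \<le> real (d - 1) * \<Delta>"
  using degree_le[of i] by (simp add: walk_degree_def mult_left_mono)

lemma walk_degree_ge:
  assumes i: "i \<in> vertices n"
  shows "\<kappa> \<le> real (walk_degree d E i)"
proof -
  have "\<kappa> \<le> 1 * real (card {e \<in> E. i \<in> e})"
    using degree_ge[OF i] by simp
  also have "\<dots> \<le> real (d - 1) * real (card {e \<in> E. i \<in> e})"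
    using d by (intro mult_right_mono) auto
  finally show ?thesis
    by (simp add: walk_degree_def)
qed

lemma sum_pair_weight:
  assumes i: "i \<in> vertices n"
  shows "(\<Sum>j\<in>vertices n. pair_weight E i j) = real (walk_degree d E i)"
proof -
  have "(\<Sum>j\<in>vertices n. pmf (walk_step E i) j) = 1"
    using set_pmf_walk_step[OF d E star_nonempty[OF i]] by (intro sum_pmf_eq_1) (auto simp: vertices_def)
  then show ?thesis
    using walk_degree_pos[OF i]
    by (simp add: pmf_walk_step[OF d E star_nonempty[OF i]] divide_eq_eq flip: sum_divide_distrib)
qed

definition total_degree :: real where
  "total_degree = (\<Sum>j\<in>vertices n. real (walk_degree d E j))"

lemma total_degree_pos: "0 < total_degree"
  unfolding total_degree_def using walk_degree_pos n
  by (intro sum_pos) (auto simp: vertices_def)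

lemma invariant_prob_eq: "invariant_prob d n E i = real (walk_degree d E i) / total_degree"
  by (simp add: invariant_prob_def total_degree_def)

lemma flow_eq:
  "i \<in> vertices n \<Longrightarrow> invariant_prob d n E i * pmf (walk_step E i) j = pair_weight E i j / total_degree"
  using walk_degree_pos[of i]
  by (simp add: invariant_prob_eq pmf_walk_step[OF d E star_nonempty])

sublocale walk: reversible_chain "vertices n" "walk_step E" "invariant_prob d n E"
proof
  show "finite (vertices n)"
    by (simp add: vertices_def)
  show "set_pmf (walk_step E i) \<subseteq> vertices n" if "i \<in> vertices n" for i
    by (rule set_pmf_walk_step[OF d E star_nonempty[OF that]])
  show "0 < invariant_prob d n E i" if "i \<in> vertices n" for i
    using walk_degree_pos[OF that] total_degree_pos by (simp add: invariant_prob_eq)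
  show "(\<Sum>i\<in>vertices n. invariant_prob d n E i) = 1"
    using total_degree_pos by (simp add: invariant_prob_eq total_degree_def flip: sum_divide_distrib)
  show "invariant_prob d n E i * pmf (walk_step E i) j = invariant_prob d n E j * pmf (walk_step E j) i"
    if "i \<in> vertices n" "j \<in> vertices n" for i j
    using that by (simp add: flow_eq pair.w_sym)
qed

definition gap :: real where
  "gap = \<kappa>\<^sup>2 / (2 * (real (d - 1) * \<Delta>)\<^sup>2)"

lemma \<Delta>_pos: "0 < \<Delta>"
  using degree_ge[of 1] degree_le[of 1] \<kappa>_pos n by (auto simp: vertices_def)

text \<open>
Cheeger's inequality for the counting measure passes to the invariant measure because all degrees
are at most \<open>D = (d - 1) \<Delta>\<close>: one factor \<open>D\<close> in the gap comes from Cheeger's inequality itself and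
one from comparing \<open>\<pi>\<close> with the counting measure.
\<close>

sublocale walk: chain_with_gap "vertices n" "walk_step E" "invariant_prob d n E" gap
proof
  let ?V = "vertices n"
  define D where "D = real (d - 1) * \<Delta>"
  have D: "0 < D"
    using \<Delta>_pos d by (simp add: D_def)
  have gap: "gap = \<kappa>\<^sup>2 / (2 * D\<^sup>2)"
    by (simp add: gap_def D_def)
  show "0 < gap"
    using \<kappa>_pos D by (simp add: gap)
  fix f :: "nat \<Rightarrow> real"
  assume mean0: "walk.mean f = 0"
  have "\<exists>c. \<kappa>\<^sup>2 * (\<Sum>i\<in>?V. (f i - c)\<^sup>2) \<le> D * (\<Sum>i\<in>?V. \<Sum>j\<in>?V. pair_weight E i j * (f i - f j)\<^sup>2)"
  proof (rule pair.Cheeger)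
    show "\<kappa> * real (card S) \<le> pair.cut S" if "S \<subseteq> ?V" "2 * card S \<le> card ?V" for S
      using cut_ge[of S] that by (simp add: vertices_def)
    show "(\<Sum>j\<in>?V. pair_weight E i j) \<le> D" if "i \<in> ?V" for i
      using walk_degree_le[OF that] by (simp add: sum_pair_weight[OF that] D_def)
  qed (use \<kappa>_pos D in auto)
  then obtain c where c: "\<kappa>\<^sup>2 * (\<Sum>i\<in>?V. (f i - c)\<^sup>2)
      \<le> D * (\<Sum>i\<in>?V. \<Sum>j\<in>?V. pair_weight E i j * (f i - f j)\<^sup>2)"
    by blast
  have energy: "walk.energy f f
      = (\<Sum>i\<in>?V. \<Sum>j\<in>?V. pair_weight E i j * (f i - f j)\<^sup>2) / (2 * total_degree)"
    unfolding walk.energy_def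
    by (simp add: flow_eq power2_eq_square sum_divide_distrib mult.commute cong: sum.cong)
  have "walk.mean (\<lambda>i. (f i)\<^sup>2) \<le> walk.mean (\<lambda>i. (f i)\<^sup>2) - 2 * c * walk.mean f + c\<^sup>2 * (\<Sum>i\<in>?V. invariant_prob d n E i)"
    by (simp add: mean0 walk.sum_\<pi>)
  also have "\<dots> = walk.mean (\<lambda>i. (f i - c)\<^sup>2)"
    unfolding walk.mean_def sum_distrib_left sum_subtractf[symmetric] sum.distrib[symmetric]
    by (intro sum.cong refl) (simp add: power2_eq_square algebra_simps)
  also have "\<dots> \<le> (\<Sum>i\<in>?V. D / total_degree * (f i - c)\<^sup>2)"
    unfolding walk.mean_def invariant_prob_eq
    using walk_degree_le total_degree_pos unfolding D_def by (intro sum_mono mult_right_mono divide_right_mono) auto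
  finally have "gap * walk.mean (\<lambda>i. (f i)\<^sup>2) \<le> gap * (D / total_degree * (\<Sum>i\<in>?V. (f i - c)\<^sup>2))"
    unfolding sum_distrib_left[symmetric] using \<open>0 < gap\<close> by (intro mult_left_mono) auto
  also have "\<dots> = (\<kappa>\<^sup>2 * (\<Sum>i\<in>?V. (f i - c)\<^sup>2)) / (2 * D * total_degree)"
    using D by (simp add: gap power2_eq_square)
  also have "\<dots> \<le> (D * (\<Sum>i\<in>?V. \<Sum>j\<in>?V. pair_weight E i j * (f i - f j)\<^sup>2)) / (2 * D * total_degree)"
    using c D total_degree_pos by (intro divide_right_mono) auto
  also have "\<dots> = walk.energy f f"
    using D unfolding energy by simp
  finally show "gap * walk.mean (\<lambda>i. (f i)\<^sup>2) \<le> walk.energy f f" .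
qed

lemma walk_step_le:
  assumes "k \<in> vertices n" "j \<in> vertices n"
  shows "pmf (walk_step E k) j \<le> \<eta> / \<kappa>"
proof -
  have "pair_weight E k j \<le> \<eta>"
    using codegree_le[of k j] assms \<eta>_nonneg by (simp add: pair_weight_def)
  then show ?thesis
    using walk_degree_ge[OF assms(1)] \<kappa>_pos \<eta>_nonneg
    by (simp add: pmf_walk_step[OF d E star_nonempty[OF assms(1)]] frac_le)
qed

lemma expected_hitting_time_eq:
  assumes i: "i \<in> vertices n" and j: "j \<in> vertices n"
  shows "expected_hitting_time E i j = ennreal (walk.hit j i)"
proof (cases "i = j")
  case True
  then show ?thesis
    unfolding expected_hitting_time_def walk.hit_def
    using expectation_hitting_time[of "vertices n" "walk_step E" i j] walk.finite_V walk.closed i by simp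
next
  case False
  then show ?thesis
    unfolding expected_hitting_time_def walk.hit_def
    using expectation_hitting_time[of "vertices n" "walk_step E" i j] walk.finite_V walk.closed i
      walk.summable_survival[OF j i False]
    by (simp add: suminf_ennreal2 survival_nonneg)
qed

lemma avg_starting_hitting_time_eq:
  assumes i: "i \<in> vertices n"
  shows "avg_starting_hitting_time d n E i
    = ennreal (\<Sum>j\<in>vertices n. invariant_prob d n E j * walk.hit j i)"
proof -
  have "avg_starting_hitting_time d n E i
      = (\<Sum>j\<in>vertices n. ennreal (invariant_prob d n E j * walk.hit j i))"
    unfolding avg_starting_hitting_time_def
    using walk.\<pi>_pos walk.hit_nonneg[OF _ i]
    by (intro sum.cong refl) (simp add: expected_hitting_time_eq[OF i] ennreal_mult less_imp_le)
  also have "\<dots> = ennreal (\<Sum>j\<in>vertices n. invariant_prob d n E j * walk.hit j i)"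
    using walk.\<pi>_pos walk.hit_nonneg[OF _ i]
    by (intro sum_ennreal mult_nonneg_nonneg) (auto simp: less_imp_le)
  finally show ?thesis .
qed

theorem avg_starting_hitting_time_bounds:
  assumes i: "i \<in> vertices n"
    and \<epsilon>: "0 < \<epsilon>" "(1 + \<epsilon>) * (\<eta> / \<kappa>) \<le> gap * \<epsilon>\<^sup>2"
  shows "ennreal (real n - 2) \<le> avg_starting_hitting_time d n E i"
    and "avg_starting_hitting_time d n E i \<le> ennreal ((1 + \<epsilon>) * real n)"
  using walk.average_hit_bounds[OF i walk_step_le \<epsilon>]
  by (simp_all add: avg_starting_hitting_time_eq[OF i] vertices_def ennreal_leI)

end

section \<open>Expansion of the random hypergraph\<close>

lemma set_random_hypergraph: "set_pmf (random_hypergraph d n p) \<subseteq> Pow (potential_edges d n)"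
  by (auto simp: random_hypergraph_def)

lemma finite_set_random_hypergraph: "finite (set_pmf (random_hypergraph d n p))"
  by (rule finite_subset[OF set_random_hypergraph]) (simp add: finite_potential_edges)

lemma expectation_exp_edge_count:
  assumes p: "0 \<le> p" "p \<le> 1" and T: "T \<subseteq> potential_edges d n"
  shows "measure_pmf.expectation (random_hypergraph d n p) (\<lambda>E. exp (\<theta> * real (card (E \<inter> T))))
    = (1 + (exp \<theta> - 1) * p) ^ card T"
proof -
  let ?P = "potential_edges d n"
  have "exp (\<theta> * real (card ({e \<in> ?P. f e} \<inter> T))) = (\<Prod>e\<in>?P. if f e \<and> e \<in> T then exp \<theta> else 1)" for f
  proof -
    have "{e \<in> ?P. f e} \<inter> T = ?P \<inter> {e. f e \<and> e \<in> T}"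
      by auto
    then show ?thesis
      by (simp add: prod.If_cases finite_potential_edges mult.commute flip: exp_of_nat_mult)
  qed
  then have "measure_pmf.expectation (random_hypergraph d n p) (\<lambda>E. exp (\<theta> * real (card (E \<inter> T))))
     = measure_pmf.expectation (Pi_pmf ?P False (\<lambda>_. bernoulli_pmf p))
         (\<lambda>f. \<Prod>e\<in>?P. if f e \<and> e \<in> T then exp \<theta> else 1)"
    by (simp add: random_hypergraph_def)
  also have "\<dots> = (\<Prod>e\<in>?P. measure_pmf.expectation (bernoulli_pmf p) (\<lambda>b. if b \<and> e \<in> T then exp \<theta> else 1))"
    by (rule expectation_prod_Pi_pmf)
      (auto intro: finite_potential_edges integrable_measure_pmf_finite)
  also have "\<dots> = (\<Prod>e\<in>?P. if e \<in> T then 1 + (exp \<theta> - 1) * p else 1)"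
    using p by (intro prod.cong refl) (auto simp: algebra_simps)
  also have "\<dots> = (1 + (exp \<theta> - 1) * p) ^ card T"
    using T by (simp add: prod.If_cases finite_potential_edges Int_absorb1)
  finally show ?thesis .
qed

lemma exponential_Markov:
  assumes p: "0 \<le> p" "p \<le> 1" and T: "T \<subseteq> potential_edges d n"
  shows "measure_pmf.prob (random_hypergraph d n p) {E. a \<le> \<theta> * real (card (E \<inter> T))}
    \<le> exp ((exp \<theta> - 1) * p * real (card T) - a)"
proof -
  let ?H = "random_hypergraph d n p"
  have "measure_pmf.prob ?H {E. a \<le> \<theta> * real (card (E \<inter> T))}
      = measure_pmf.expectation ?H (indicator {E. a \<le> \<theta> * real (card (E \<inter> T))})"
    by simp
  also have "\<dots> \<le> measure_pmf.expectation ?H (\<lambda>E. exp (- a) * exp (\<theta> * real (card (E \<inter> T))))"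
    by (intro integral_mono integrable_measure_pmf_finite finite_set_random_hypergraph)
      (auto simp: indicator_def simp flip: exp_add)
  also have "\<dots> = exp (- a) * (1 + (exp \<theta> - 1) * p) ^ card T"
    by (simp add: expectation_exp_edge_count[OF p T])
  also have "\<dots> \<le> exp (- a) * exp ((exp \<theta> - 1) * p) ^ card T"
  proof (intro mult_left_mono power_mono)
    have "(1 - exp \<theta>) * p \<le> 1 * 1"
      using p by (intro mult_mono) auto
    then show "0 \<le> 1 + (exp \<theta> - 1) * p"
      by (simp add: algebra_simps)
  qed auto
  also have "\<dots> = exp ((exp \<theta> - 1) * p * real (card T) - a)"
    by (simp add: exp_of_nat_mult[symmetric] exp_add[symmetric] algebra_simps)
  finally show ?thesis .
qed

text \<open>
Markov's inequality for \<open>exp (- X)\<close> gives the exponent \<open>p t / 4 - (1 - 1 / e) p t\<close>, and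
\<open>1 - 1 / e \<ge> 1 / 2\<close>.
\<close>

lemma prob_few_edges:
  assumes p: "0 \<le> p" "p \<le> 1" and T: "T \<subseteq> potential_edges d n" and t: "t \<le> real (card T)"
  shows "measure_pmf.prob (random_hypergraph d n p) {E. real (card (E \<inter> T)) < p * t / 4}
    \<le> exp (- (p * t / 4))"
proof -
  have "2 * exp (- 1) \<le> (1 :: real)"
    using exp_ge_add_one_self[of 1] by (simp add: exp_minus field_simps)
  then have "(exp (- 1) - 1) * (p * real (card T)) \<le> (- 1 / 2) * (p * real (card T))"
    using p by (intro mult_right_mono) auto
  moreover have "p * t \<le> p * real (card T)"
    using t p by (intro mult_left_mono) auto
  ultimately have exponent: "(exp (- 1) - 1) * p * real (card T) - (- (p * t / 4)) \<le> - (p * t / 4)"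
    by (simp add: mult.assoc)
  have "measure_pmf.prob (random_hypergraph d n p) {E. real (card (E \<inter> T)) < p * t / 4}
      \<le> measure_pmf.prob (random_hypergraph d n p) {E. - (p * t / 4) \<le> - 1 * real (card (E \<inter> T))}"
    by (intro measure_pmf.finite_measure_mono) auto
  also have "\<dots> \<le> exp ((exp (- 1) - 1) * p * real (card T) - (- (p * t / 4)))"
    by (rule exponential_Markov[OF p T])
  also have "\<dots> \<le> exp (- (p * t / 4))"
    using exponent by simp
  finally show ?thesis .
qed

text \<open>
Markov's inequality for \<open>exp X\<close> gives the exponent \<open>(e - 1) p t - a\<close>, and \<open>e \<le> 3\<close>.
\<close>

lemma prob_many_edges:
  assumes p: "0 \<le> p" "p \<le> 1" and T: "T \<subseteq> potential_edges d n" and t: "real (card T) \<le> t"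
  shows "measure_pmf.prob (random_hypergraph d n p) {E. a < real (card (E \<inter> T))}
    \<le> exp (2 * p * t - a)"
proof -
  have "(exp 1 - 1) * (p * real (card T)) \<le> 2 * (p * t)"
    using exp_le p t by (intro mult_mono mult_nonneg_nonneg) auto
  then have exponent: "(exp 1 - 1) * p * real (card T) - a \<le> 2 * p * t - a"
    by (simp add: mult.assoc)
  have "measure_pmf.prob (random_hypergraph d n p) {E. a < real (card (E \<inter> T))}
      \<le> measure_pmf.prob (random_hypergraph d n p) {E. a \<le> 1 * real (card (E \<inter> T))}"
    by (intro measure_pmf.finite_measure_mono) auto
  also have "\<dots> \<le> exp ((exp 1 - 1) * p * real (card T) - a)"
    by (rule exponential_Markov[OF p T])
  also have "\<dots> \<le> exp (2 * p * t - a)"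
    using exponent by simp
  finally show ?thesis .
qed

text \<open>
For \<open>S\<close> of at most \<open>n / 2\<close> vertices, each vertex of \<open>S\<close> can be completed to a crossing hyperedge in
at least \<open>(n / 2) choose (d - 1)\<close> ways, and \<open>m choose k \<ge> (m / k)\<^sup>k\<close> bounds this number from below by
the constant times \<open>n\<^bsup>d - 1\<^esup>\<close>.
\<close>

definition crossing_const :: "nat \<Rightarrow> real" where
  "crossing_const d = (1 / (2 * real (d - 1))) ^ (d - 1)"

text \<open>
Inserting one vertex of \<open>S\<close> into \<open>d - 1\<close> vertices outside of \<open>S\<close> is injective, since the result reveals
both, and at least half of the vertices are outside.
\<close>

lemma card_crossing_ge:
  assumes d: "2 \<le> d" and n: "2 * (d - 1) \<le> n" and S: "S \<subseteq> vertices n" "2 * card S \<le> n"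
  shows "crossing_const d * real n ^ (d - 1) * real (card S)
    \<le> real (card {e \<in> potential_edges d n. card (e \<inter> S) = 1})"
proof -
  define A where "A = {B. B \<subseteq> vertices n - S \<and> card B = d - 1}"
  have finV: "finite (vertices n)"
    by (simp add: vertices_def)
  have finS: "finite S"
    using S(1) finV by (rule finite_subset)
  have card_A: "card A = (n - card S) choose (d - 1)"
    unfolding A_def using finV finS S(1)
    by (subst n_subsets) (auto simp: card_Diff_subset vertices_def)
  have "(\<lambda>(i, B). insert i B) ` (S \<times> A) \<subseteq> {e \<in> potential_edges d n. card (e \<inter> S) = 1}"
  proof safe
    fix i B assume i: "i \<in> S" and B: "B \<in> A"
    have "finite B" "i \<notin> B" "insert i B \<inter> S = {i}"
      using i B finV by (auto simp: A_def dest: finite_subset)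
    then show "insert i B \<in> potential_edges d n" "card (insert i B \<inter> S) = 1"
      using i B S(1) d by (auto simp: A_def potential_edges_def)
  qed
  moreover have "inj_on (\<lambda>(i, B). insert i B) (S \<times> A)"
  proof (rule inj_onI, clarify)
    fix i j B C assume ij: "i \<in> S" "j \<in> S" and BC: "B \<in> A" "C \<in> A" and eq: "insert i B = insert j C"
    have "{i} = insert i B \<inter> S" "{j} = insert j C \<inter> S" "B = insert i B - S" "C = insert j C - S"
      using ij BC by (auto simp: A_def)
    with eq show "i = j \<and> B = C"
      by (metis singleton_inject)
  qed
  moreover have "finite (S \<times> A)" "finite {e \<in> potential_edges d n. card (e \<inter> S) = 1}"
    using finS finV finite_potential_edges[of d n] by (auto simp: A_def)
  ultimately have "card (S \<times> A) \<le> card {e \<in> potential_edges d n. card (e \<inter> S) = 1}"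
    using card_inj_on_le by blast
  then have "real (card S) * real (card A) \<le> real (card {e \<in> potential_edges d n. card (e \<inter> S) = 1})"
    unfolding card_cartesian_product by (metis of_nat_le_iff of_nat_mult)
  moreover have "crossing_const d * real n ^ (d - 1) \<le> real (card A)"
  proof -
    have "crossing_const d * real n ^ (d - 1) = (real n / (2 * real (d - 1))) ^ (d - 1)"
      by (simp add: crossing_const_def power_divide power_mult_distrib)
    also have "\<dots> = ((real n / 2) / real (d - 1)) ^ (d - 1)"
      by simp
    also have "\<dots> \<le> (real (n - card S) / real (d - 1)) ^ (d - 1)"
      using S(2) by (intro power_mono divide_right_mono) auto
    also have "\<dots> \<le> real ((n - card S) choose (d - 1))"
      using S(2) n by (intro binomial_ge_n_over_k_pow_k) linarith
    finally show ?thesis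
      by (simp only: card_A)
  qed
  then have "crossing_const d * real n ^ (d - 1) * real (card S) \<le> real (card A) * real (card S)"
    by (rule mult_right_mono) simp
  ultimately show ?thesis
    by (simp add: mult.commute)
qed

lemma card_edges_containing_le:
  assumes X: "X \<subseteq> vertices n" and r: "card X \<le> d" "d - card X \<le> n"
  shows "card {e \<in> potential_edges d n. X \<subseteq> e} \<le> n ^ (d - card X)"
proof -
  have finV: "finite (vertices n)"
    by (simp add: vertices_def)
  have finX: "finite X"
    using X finV by (rule finite_subset)
  have "(\<lambda>e. e - X) ` {e \<in> potential_edges d n. X \<subseteq> e} \<subseteq> {B. B \<subseteq> vertices n \<and> card B = d - card X}"
    using finX by (auto simp: potential_edges_def card_Diff_subset)
  moreover have "inj_on (\<lambda>e. e - X) {e \<in> potential_edges d n. X \<subseteq> e}"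
    by (rule inj_onI) blast
  moreover have "finite {B. B \<subseteq> vertices n \<and> card B = d - card X}"
    using finV by simp
  ultimately have "card {e \<in> potential_edges d n. X \<subseteq> e} \<le> card {B. B \<subseteq> vertices n \<and> card B = d - card X}"
    using card_inj_on_le by blast
  also have "\<dots> = n choose (d - card X)"
    using finV by (simp add: n_subsets vertices_def)
  also have "\<dots> \<le> n ^ (d - card X)"
    using r(2) by (rule binomial_le_pow)
  finally show ?thesis .
qed

lemma sum_power_card_Pow:
  fixes q :: real
  assumes "finite A"
  shows "(\<Sum>X\<in>Pow A. q ^ card X) = (1 + q) ^ card A"
  using prod_add[OF assms, of "\<lambda>_. q" "\<lambda>_. 1"] by (simp add: add.commute)

text \<open>
A union bound over the sets \<open>S\<close>, the vertices and the pairs of vertices. The exponential bound for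
a set \<open>S\<close> is \<open>q\<^bsup>|S|\<^esup>\<close> with \<open>q = exp (- c M / 4)\<close>, so the sum over all nonempty sets is at most
\<open>(1 + q)\<^sup>n - 1\<close> by the binomial theorem. Here \<open>M\<close> is of the order of the expected number of
hyperedges at a vertex, and a pair of vertices has only about \<open>M / n\<close> common hyperedges.
\<close>

lemma prob_not_expanding:
  assumes d: "2 \<le> d" and n: "2 * (d - 1) \<le> n" and p: "0 < p" "p \<le> 1" and \<beta>: "0 < \<beta>"
  defines "M \<equiv> p * real n ^ (d - 1)" and "c \<equiv> crossing_const d"
  shows "measure_pmf.prob (random_hypergraph d n p)
      {E. \<not> expanding_hypergraph d n E (c * M / 4) (3 * M) (\<beta> * M)}
    \<le> ((1 + exp (- (c * M / 4))) ^ n - 1) + real n * exp (- M)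
      + (real n)\<^sup>2 * exp (2 * M / real n - \<beta> * M)"
proof -
  let ?V = "vertices n" and ?H = "random_hypergraph d n p" and ?P = "potential_edges d n"
  let ?prob = "measure_pmf.prob ?H"
  have n0: "2 \<le> n"
    using d n by simp
  have finV: "finite ?V" and card_V: "card ?V = n"
    by (simp_all add: vertices_def)
  have M_pos: "0 < M"
    using p n0 by (simp add: M_def)
  have c_pos: "0 < c"
    using d by (simp add: c_def crossing_const_def)
  define cross where "cross S = {e \<in> ?P. card (e \<inter> S) = 1}" for S
  define star where "star X = {e \<in> ?P. X \<subseteq> e}" for X
  define bad1 where "bad1 S = {E. real (card (E \<inter> cross S)) < p * (c * real n ^ (d - 1) * real (card S)) / 4}" for S
  define bad2 where "bad2 i = {E. 3 * M < real (card (E \<inter> star {i}))}" for i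
  define bad3 where "bad3 ij = {E. \<beta> * M < real (card (E \<inter> star {fst ij, snd ij}))}" for ij
  define sets where "sets = {S \<in> Pow ?V - {{}}. 2 * card S \<le> n}"
  define pairs where "pairs = {ij \<in> ?V \<times> ?V. fst ij \<noteq> snd ij}"
  have fin: "finite sets" "finite pairs"
    using finV by (auto simp: sets_def pairs_def)
  have covered: "E \<in> (\<Union>S\<in>sets. bad1 S) \<union> (\<Union>i\<in>?V. bad2 i) \<union> (\<Union>ij\<in>pairs. bad3 ij)"
    if E: "E \<subseteq> ?P" and not_exp: "\<not> expanding_hypergraph d n E (c * M / 4) (3 * M) (\<beta> * M)" for E
  proof (rule ccontr)
    assume good: "E \<notin> (\<Union>S\<in>sets. bad1 S) \<union> (\<Union>i\<in>?V. bad2 i) \<union> (\<Union>ij\<in>pairs. bad3 ij)"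
    have cross_eq: "E \<inter> cross S = {e \<in> E. card (e \<inter> S) = 1}"
      and star_eq: "E \<inter> star X = {e \<in> E. X \<subseteq> e}" for S X
      using E by (auto simp: cross_def star_def)
    have "expanding_hypergraph d n E (c * M / 4) (3 * M) (\<beta> * M)"
    proof
      fix S assume S: "S \<subseteq> ?V" "2 * card S \<le> n"
      show "c * M / 4 * real (card S) \<le> real (card {e \<in> E. card (e \<inter> S) = 1})"
      proof (cases "S = {}")
        case False
        then have "S \<in> sets"
          using S by (auto simp: sets_def)
        then have "E \<notin> bad1 S"
          using good by blast
        then show ?thesis
          by (simp add: bad1_def cross_eq M_def mult_ac)
      qed simp
    next
      fix i assume "i \<in> ?V"
      then have "E \<notin> bad2 i"
        using good by blast
      then show "real (card {e \<in> E. i \<in> e}) \<le> 3 * M"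
        by (simp add: bad2_def star_eq)
    next
      fix i j assume "i \<in> ?V" "j \<in> ?V" "i \<noteq> j"
      then have "(i, j) \<in> pairs"
        by (simp add: pairs_def)
      then have "E \<notin> bad3 (i, j)"
        using good by blast
      then show "real (card {e \<in> E. i \<in> e \<and> j \<in> e}) \<le> \<beta> * M"
        by (simp add: bad3_def star_eq)
    qed (use d n0 E c_pos M_pos \<beta> in auto)
    with not_exp show False ..
  qed
  have prob1: "?prob (bad1 S) \<le> exp (- (c * M / 4)) ^ card S" if "S \<in> sets" for S
  proof -
    have "?prob (bad1 S) \<le> exp (- (p * (c * real n ^ (d - 1) * real (card S)) / 4))"
      unfolding bad1_def c_def
      using p card_crossing_ge[OF d n] that
      by (intro prob_few_edges) (auto simp: cross_def sets_def)
    also have "\<dots> = exp (- (c * M / 4)) ^ card S"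
      by (simp add: M_def mult_ac flip: exp_of_nat_mult)
    finally show ?thesis .
  qed
  have prob2: "?prob (bad2 i) \<le> exp (- M)" if i: "i \<in> ?V" for i
  proof -
    have "card (star {i}) \<le> n ^ (d - 1)"
      unfolding star_def using card_edges_containing_le[of "{i}" n d] i d n by simp
    then have "?prob (bad2 i) \<le> exp (2 * p * real n ^ (d - 1) - 3 * M)"
      unfolding bad2_def using p
      by (intro prob_many_edges) (auto simp: star_def simp flip: of_nat_power)
    then show ?thesis
      by (simp add: M_def)
  qed
  have prob3: "?prob (bad3 ij) \<le> exp (2 * M / real n - \<beta> * M)" if ij: "ij \<in> pairs" for ij
  proof -
    have "card {fst ij, snd ij} = 2" "{fst ij, snd ij} \<subseteq> ?V"
      using ij by (auto simp: pairs_def)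
    then have "card (star {fst ij, snd ij}) \<le> n ^ (d - 2)"
      unfolding star_def using card_edges_containing_le[of "{fst ij, snd ij}" n d] d n by simp
    then have "?prob (bad3 ij) \<le> exp (2 * p * real n ^ (d - 2) - \<beta> * M)"
      unfolding bad3_def using p
      by (intro prob_many_edges) (auto simp: star_def simp flip: of_nat_power)
    also have "d - 1 = Suc (d - 2)"
      using d by simp
    then have "2 * p * real n ^ (d - 2) = 2 * M / real n"
      using n0 by (simp add: M_def)
    finally show ?thesis .
  qed
  have "?prob {E. \<not> expanding_hypergraph d n E (c * M / 4) (3 * M) (\<beta> * M)}
      \<le> ?prob ((\<Union>S\<in>sets. bad1 S) \<union> (\<Union>i\<in>?V. bad2 i) \<union> (\<Union>ij\<in>pairs. bad3 ij))"
    using covered set_random_hypergraph[of d n p]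
    by (intro measure_pmf.finite_measure_mono_AE) (auto simp: AE_measure_pmf_iff)
  also have "\<dots> \<le> ?prob ((\<Union>S\<in>sets. bad1 S) \<union> (\<Union>i\<in>?V. bad2 i)) + ?prob (\<Union>ij\<in>pairs. bad3 ij)"
    by (rule measure_Un_le) auto
  also have "\<dots> \<le> ?prob (\<Union>S\<in>sets. bad1 S) + ?prob (\<Union>i\<in>?V. bad2 i) + ?prob (\<Union>ij\<in>pairs. bad3 ij)"
    by (intro add_right_mono measure_Un_le) auto
  also have "\<dots> \<le> (\<Sum>S\<in>sets. ?prob (bad1 S)) + (\<Sum>i\<in>?V. ?prob (bad2 i)) + (\<Sum>ij\<in>pairs. ?prob (bad3 ij))"
    using fin finV by (intro add_mono measure_UNION_le) auto
  also have "\<dots> \<le> ((1 + exp (- (c * M / 4))) ^ n - 1) + real n * exp (- M)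
      + (real n)\<^sup>2 * exp (2 * M / real n - \<beta> * M)"
  proof (intro add_mono)
    have "(\<Sum>S\<in>sets. ?prob (bad1 S)) \<le> (\<Sum>S\<in>sets. exp (- (c * M / 4)) ^ card S)"
      by (intro sum_mono prob1)
    also have "\<dots> \<le> (\<Sum>S\<in>Pow ?V - {{}}. exp (- (c * M / 4)) ^ card S)"
      using finV by (intro sum_mono2) (auto simp: sets_def)
    also have "\<dots> = (1 + exp (- (c * M / 4))) ^ n - 1"
      using finV by (simp add: sum_diff1 sum_power_card_Pow card_V)
    finally show "(\<Sum>S\<in>sets. ?prob (bad1 S)) \<le> (1 + exp (- (c * M / 4))) ^ n - 1" .
    have "(\<Sum>i\<in>?V. ?prob (bad2 i)) \<le> (\<Sum>i\<in>?V. exp (- M))"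
      by (intro sum_mono prob2)
    then show "(\<Sum>i\<in>?V. ?prob (bad2 i)) \<le> real n * exp (- M)"
      by (simp add: card_V)
    have "card pairs \<le> card (?V \<times> ?V)"
      using finV by (intro card_mono) (auto simp: pairs_def)
    then have "real (card pairs) \<le> (real n)\<^sup>2"
      by (simp add: card_cartesian_product card_V power2_eq_square flip: of_nat_mult)
    moreover have "(\<Sum>ij\<in>pairs. ?prob (bad3 ij)) \<le> real (card pairs) * exp (2 * M / real n - \<beta> * M)"
      using sum_mono[OF prob3, of pairs "\<lambda>x. x"] by simp
    ultimately show "(\<Sum>ij\<in>pairs. ?prob (bad3 ij)) \<le> (real n)\<^sup>2 * exp (2 * M / real n - \<beta> * M)"
      by (meson exp_ge_zero mult_right_mono order_trans)
  qed
  finally show ?thesis .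
qed

lemma edge_density_dominates_log:
  fixes p :: "nat \<Rightarrow> real"
  assumes p: "\<And>n. n \<ge> 1 \<Longrightarrow> 0 < p n \<and> p n < 1"
    and lim: "(\<lambda>n. (ln (real n) ^ 4 / real n ^ (d - 1)) / (p n * (1 - p n))) \<longlonglongrightarrow> 0"
    and C: "0 < C"
  shows "\<forall>\<^sub>F n in sequentially. C * ln (real n) \<le> p n * real n ^ (d - 1)"
proof -
  have "\<forall>\<^sub>F n in sequentially. (ln (real n) ^ 4 / real n ^ (d - 1)) / (p n * (1 - p n)) < 1 / C"
    using order_tendstoD(2)[OF lim, of "1 / C"] C by simp
  with eventually_ge_at_top[of 3] show ?thesis
  proof eventually_elim
    case (elim n)
    have n: "0 < real n ^ (d - 1)" "0 < p n" "p n < 1"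
      using elim(1) p[of n] by auto
    have "1 \<le> ln (real n)"
      using elim(1) exp_le by (subst ln_ge_iff) auto
    then have "ln (real n) \<le> ln (real n) ^ 4"
      using power_increasing[of 1 4 "ln (real n)"] by simp
    then have "C * ln (real n) \<le> C * ln (real n) ^ 4"
      using C by simp
    also have "\<dots> \<le> (p n * (1 - p n)) * real n ^ (d - 1)"
      using elim(2) n C by (simp add: field_simps)
    also have "\<dots> \<le> p n * real n ^ (d - 1)"
      using n by (intro mult_right_mono) auto
    finally show ?case .
  qed
qed

lemma prob_not_expanding_tendsto_0:
  fixes p :: "nat \<Rightarrow> real"
  assumes d: "2 \<le> d" and p: "\<And>n. n \<ge> 1 \<Longrightarrow> 0 < p n \<and> p n < 1"
    and lim: "(\<lambda>n. (ln (real n) ^ 4 / real n ^ (d - 1)) / (p n * (1 - p n))) \<longlonglongrightarrow> 0"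
    and \<beta>: "0 < \<beta>"
  defines "M \<equiv> \<lambda>n. p n * real n ^ (d - 1)" and "c \<equiv> crossing_const d"
  shows "(\<lambda>n. measure_pmf.prob (random_hypergraph d n (p n))
    {E. \<not> expanding_hypergraph d n E (c * M n / 4) (3 * M n) (\<beta> * M n)}) \<longlonglongrightarrow> 0"
proof (rule tendsto_sandwich)
  show "\<forall>\<^sub>F n in sequentially. 0 \<le> measure_pmf.prob (random_hypergraph d n (p n))
      {E. \<not> expanding_hypergraph d n E (c * M n / 4) (3 * M n) (\<beta> * M n)}"
    by simp
  show "(\<lambda>_. 0 :: real) \<longlonglongrightarrow> 0"
    by simp
  show "(\<lambda>n. exp (1 / real n) - 1 + 1 / real n + 1 / real n) \<longlonglongrightarrow> 0"
    by (auto intro!: tendsto_eq_intros lim_1_over_n)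
  have c_pos: "0 < c"
    using d by (simp add: c_def crossing_const_def)
  have log: "\<forall>\<^sub>F n in sequentially. C * ln (real n) \<le> p n * real n ^ (d - 1)" if "0 < C" for C
    using that by (intro edge_density_dominates_log p lim)
  have c': "0 < 8 / c" and \<beta>': "0 < 6 / \<beta>"
    using c_pos \<beta> by simp_all
  have large: "\<forall>\<^sub>F n in sequentially. nat \<lceil>4 / \<beta>\<rceil> \<le> n"
    by (rule eventually_ge_at_top)
  show "\<forall>\<^sub>F n in sequentially. measure_pmf.prob (random_hypergraph d n (p n))
      {E. \<not> expanding_hypergraph d n E (c * M n / 4) (3 * M n) (\<beta> * M n)}
    \<le> exp (1 / real n) - 1 + 1 / real n + 1 / real n"
    using log[OF c'] log[of 2, simplified] log[OF \<beta>'] large eventually_ge_at_top[of "2 * (d - 1)"]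
  proof eventually_elim
    case (elim n)
    have n: "0 < real n" "n \<ge> 1"
      using elim(5) d by auto
    have pn: "0 < p n" "p n \<le> 1"
      using p[OF n(2)] by auto
    have M_pos: "0 < M n"
      using n pn by (simp add: M_def)
    have M: "2 * ln (real n) \<le> c * M n / 4" "2 * ln (real n) \<le> M n" "3 * ln (real n) \<le> \<beta> * M n / 2"
      using elim(1-3) c_pos \<beta> by (simp_all add: M_def field_simps)
    \<comment> \<open>\<open>M\<close> exceeds every multiple of \<open>ln n\<close>; the powers \<open>k = 2\<close> for the sets and the vertices and
      \<open>k = 3\<close> for the pairs leave a factor \<open>1 / n\<close> after the union bound\<close>
    have exp_ln: "exp (- (real k * ln (real n))) = 1 / real n ^ k" for k
      using n by (simp add: exp_minus exp_of_nat_mult field_simps)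
    have "4 / \<beta> \<le> real n"
      using elim(4) by linarith
    then have "2 * M n / real n \<le> \<beta> * M n / 2"
      using n \<beta> M_pos by (simp add: field_simps)
    have "(1 + exp (- (c * M n / 4))) ^ n \<le> exp (1 / real n)"
    proof -
      have "exp (- (c * M n / 4)) \<le> 1 / real n ^ 2"
        using M(1) exp_ln[of 2] by (metis exp_le_cancel_iff neg_le_iff_le of_nat_numeral)
      then have "1 + exp (- (c * M n / 4)) \<le> exp (1 / real n ^ 2)"
        using exp_ge_add_one_self[of "1 / real n ^ 2"] by linarith
      then have "(1 + exp (- (c * M n / 4))) ^ n \<le> exp (1 / real n ^ 2) ^ n"
        by (intro power_mono) (auto intro: add_nonneg_nonneg)
      also have "\<dots> = exp (1 / real n)"
        using n by (simp add: power2_eq_square flip: exp_of_nat_mult)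
      finally show ?thesis .
    qed
    moreover have "real n * exp (- M n) \<le> 1 / real n"
    proof -
      have "exp (- M n) \<le> 1 / real n ^ 2"
        using M(2) exp_ln[of 2] by (metis exp_le_cancel_iff neg_le_iff_le of_nat_numeral)
      then have "real n * exp (- M n) \<le> real n * (1 / real n ^ 2)"
        using n by (intro mult_left_mono) auto
      then show ?thesis
        using n by (simp add: power2_eq_square)
    qed
    moreover have "(real n)\<^sup>2 * exp (2 * M n / real n - \<beta> * M n) \<le> 1 / real n"
    proof -
      have "2 * M n / real n - \<beta> * M n \<le> - (3 * ln (real n))"
        using M(3) \<open>2 * M n / real n \<le> \<beta> * M n / 2\<close> by linarith
      then have "exp (2 * M n / real n - \<beta> * M n) \<le> 1 / real n ^ 3"
        using exp_ln[of 3] by (metis exp_le_cancel_iff of_nat_numeral)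
      then have "(real n)\<^sup>2 * exp (2 * M n / real n - \<beta> * M n) \<le> (real n)\<^sup>2 * (1 / real n ^ 3)"
        by (intro mult_left_mono) auto
      then show ?thesis
        using n by (simp add: power2_eq_square power3_eq_cube)
    qed
    ultimately show ?case
      using prob_not_expanding[OF d elim(5) pn \<beta>] unfolding M_def c_def by linarith
  qed
qed

text \<open>
An event that is almost certain and implies the condition makes conditioning harmless: dividing by
the probability of the condition only increases the probability of the conjunction.
\<close>

lemma cond_prob_tendsto_1:
  fixes N :: "nat \<Rightarrow> 'a pmf"
  assumes good: "(\<lambda>n. measure_pmf.prob (N n) {x. \<not> G n x}) \<longlonglongrightarrow> 0"
    and PQ: "\<forall>\<^sub>F n in sequentially. \<forall>x. G n x \<longrightarrow> P n x \<and> Q n x"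
  shows "(\<lambda>n. \<P>(x in measure_pmf (N n). P n x \<bar> Q n x)) \<longlonglongrightarrow> 1"
proof (rule tendsto_sandwich)
  show "(\<lambda>n. 1 - measure_pmf.prob (N n) {x. \<not> G n x}) \<longlonglongrightarrow> 1"
    using tendsto_diff[OF tendsto_const[of 1] good] by simp
  show "(\<lambda>_. 1 :: real) \<longlonglongrightarrow> 1"
    by simp
  have cond: "\<P>(x in measure_pmf (N n). P n x \<bar> Q n x)
      = measure_pmf.prob (N n) {x. P n x \<and> Q n x} / measure_pmf.prob (N n) {x. Q n x}" for n
    by (simp add: cond_prob_def)
  have mono: "measure_pmf.prob (N n) {x. P n x \<and> Q n x} \<le> measure_pmf.prob (N n) {x. Q n x}" for n
    by (intro measure_pmf.finite_measure_mono) auto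
  show "\<forall>\<^sub>F n in sequentially. \<P>(x in measure_pmf (N n). P n x \<bar> Q n x) \<le> 1"
    unfolding cond using mono by (simp add: divide_le_eq_1 less_le)
  show "\<forall>\<^sub>F n in sequentially. 1 - measure_pmf.prob (N n) {x. \<not> G n x}
      \<le> \<P>(x in measure_pmf (N n). P n x \<bar> Q n x)"
    using PQ
  proof eventually_elim
    case (elim n)
    have "1 - measure_pmf.prob (N n) {x. \<not> G n x} = measure_pmf.prob (N n) {x. G n x}"
      using measure_pmf.prob_compl[of "{x. \<not> G n x}" "N n"] by (simp add: Compl_eq_Diff_UNIV[symmetric] Collect_neg_eq)
    also have "\<dots> \<le> measure_pmf.prob (N n) {x. P n x \<and> Q n x}"
      using elim by (intro measure_pmf.finite_measure_mono) auto
    also have "\<dots> \<le> \<P>(x in measure_pmf (N n). P n x \<bar> Q n x)"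
    proof (cases "measure_pmf.prob (N n) {x. Q n x} = 0")
      case True
      then show ?thesis
        unfolding cond using mono[of n] by simp
    next
      case False
      then have "0 < measure_pmf.prob (N n) {x. Q n x}"
        by (simp add: zero_less_measure_iff)
      moreover have "measure_pmf.prob (N n) {x. P n x \<and> Q n x} * measure_pmf.prob (N n) {x. Q n x}
          \<le> measure_pmf.prob (N n) {x. P n x \<and> Q n x}"
        by (simp add: mult_left_le)
      ultimately show ?thesis
        unfolding cond by (simp add: le_divide_eq)
    qed
    finally show ?case .
  qed
qed

section \<open>The average starting hitting time\<close>

theorem theorem4:
  fixes d :: nat and p :: "nat \<Rightarrow> real" and i :: "nat \<Rightarrow> nat" and \<epsilon> :: real
  assumes "d \<ge> 2"
    and "\<And>n. n \<ge> 1 \<Longrightarrow> 0 < p n \<and> p n < 1"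
    and "(\<lambda>n. (ln (real n) ^ 4 / real n ^ (d - 1)) / (p n * (1 - p n))) \<longlonglongrightarrow> 0"
    and "\<And>n. n \<ge> 1 \<Longrightarrow> i n \<in> vertices n"
    and "\<epsilon> > 0"
  shows "(\<lambda>n. \<P>(E in measure_pmf (random_hypergraph d n (p n)).
            ennreal (1 / 2 * (1 - \<epsilon>) * real n) \<le> avg_starting_hitting_time d n E (i n) \<and>
            avg_starting_hitting_time d n E (i n) \<le> ennreal ((1 + \<epsilon>) * real n)
            \<bar> hconnected n E)) \<longlonglongrightarrow> 1"
proof -
  define M where "M n = p n * real n ^ (d - 1)" for n
  define c where "c = crossing_const d"
  \<comment> \<open>the gap for \<open>\<kappa> = c M / 4\<close> and \<open>\<Delta> = 3 M\<close>, where \<open>M\<close> cancels: \<open>288 = 2 * 4\<^sup>2 * 3\<^sup>2\<close>\<close>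
  define \<gamma> where "\<gamma> = c\<^sup>2 / (288 * (real (d - 1))\<^sup>2)"
  define r where "r = 1 + \<epsilon>"
  \<comment> \<open>small enough that one-step probabilities, at most \<open>\<beta> M / \<kappa> = 4 \<beta> / c\<close>, are negligible
    compared with the gap\<close>
  define \<beta> where "\<beta> = c * \<gamma> * \<epsilon>\<^sup>2 / (4 * r)"
  have c_pos: "0 < c"
    using assms(1) by (simp add: c_def crossing_const_def)
  have \<gamma>_pos: "0 < \<gamma>"
    using assms(1) c_pos by (simp add: \<gamma>_def)
  have r_pos: "0 < r"
    using assms(5) by (simp add: r_def)
  have \<beta>_pos: "0 < \<beta>"
    using c_pos \<gamma>_pos r_pos assms(5) by (simp add: \<beta>_def)
  show ?thesis
  proof (rule cond_prob_tendsto_1)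
    show "(\<lambda>n. measure_pmf.prob (random_hypergraph d n (p n))
        {E. \<not> expanding_hypergraph d n E (c * M n / 4) (3 * M n) (\<beta> * M n)}) \<longlonglongrightarrow> 0"
      unfolding M_def c_def by (rule prob_not_expanding_tendsto_0[OF assms(1-3) \<beta>_pos])
    show "\<forall>\<^sub>F n in sequentially. \<forall>E. expanding_hypergraph d n E (c * M n / 4) (3 * M n) (\<beta> * M n) \<longrightarrow>
        (ennreal (1 / 2 * (1 - \<epsilon>) * real n) \<le> avg_starting_hitting_time d n E (i n) \<and>
         avg_starting_hitting_time d n E (i n) \<le> ennreal ((1 + \<epsilon>) * real n)) \<and> hconnected n E"
      using eventually_ge_at_top[of 4]
    proof (eventually_elim, intro allI impI)
      fix n E assume n4: "4 \<le> n"
        and "expanding_hypergraph d n E (c * M n / 4) (3 * M n) (\<beta> * M n)"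
      then interpret expanding_hypergraph d n E "c * M n / 4" "3 * M n" "\<beta> * M n"
        by blast
      have M_pos: "0 < M n"
        using \<kappa>_pos c_pos by (simp add: zero_less_mult_iff)
      have "gap = \<gamma>"
        using M_pos by (simp add: gap_def \<gamma>_def power2_eq_square)
      moreover have "\<beta> * M n / (c * M n / 4) = 4 * \<beta> / c"
        using M_pos by simp
      moreover have "(1 + \<epsilon>) * (4 * \<beta> / c) = \<gamma> * \<epsilon>\<^sup>2"
        unfolding \<beta>_def r_def[symmetric] using c_pos r_pos by simp
      ultimately have small: "(1 + \<epsilon>) * (\<beta> * M n / (c * M n / 4)) \<le> gap * \<epsilon>\<^sup>2"
        by simp
      have i: "i n \<in> vertices n"
        using assms(4) n4 by simp
      have "1 / 2 * (1 - \<epsilon>) * real n \<le> 1 / 2 * 1 * real n"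
        using assms(5) by (intro mult_right_mono mult_left_mono) auto
      also have "\<dots> \<le> real n - 2"
        using n4 by simp
      finally have "ennreal (1 / 2 * (1 - \<epsilon>) * real n) \<le> ennreal (real n - 2)"
        by (rule ennreal_leI)
      then show "(ennreal (1 / 2 * (1 - \<epsilon>) * real n) \<le> avg_starting_hitting_time d n E (i n) \<and>
         avg_starting_hitting_time d n E (i n) \<le> ennreal ((1 + \<epsilon>) * real n)) \<and> hconnected n E"
        using avg_starting_hitting_time_bounds[OF i assms(5) small] connected by auto
    qed
  qed
qed

end
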